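(* Let $\rho$ be an ordinal. Then $\rho$ is $\Sigma_2$-nonprojectible if and only if $\rho$ is recursively subtle.
   Context: $L_\alpha$ denotes the $\alpha$-th level of Gödel's constructible hierarchy, and $\prec_{\Sigma_n}$ denotes the relation of being a $\Sigma_n$-elementary substructure (Lévy hierarchy; parameters from the smaller structure allowed). $\Sigma_2$-nonprojectible: $\rho$ is $\Sigma_2$-nonprojectible iff the set of ordinals $\eta<\rho$ with $L_\eta \prec_{\Sigma_2} L_\rho$ is unbounded in $\rho$. $\rho$-recursively enumerable: $\mathcal{A}\subseteq L_\rho$ is $\rho$-recursively enumerable iff it is $\Sigma_1$-definable over $L_\rho$ with parameters from $L_\rho$. $\mathcal{A}$-$\rho$-stable: for a class $\mathcal{A}$ and an ordinal $\kappa<\rho$, $\kappa$ is $\mathcal{A}$-$\rho$-stable iff $\langle L_\kappa,\in,\mathcal{A}\cap L_\kappa\rangle \prec_{\Sigma_1} \langle L_\rho,\in,\mathcal{A}\cap L_\rho\rangle$, where formulas may use a unary predicate symbol for $\mathcal{A}$. $\Pi_2$-reflecting onto a class: for a class $A$ of ordinals, $\rho$ is $\Pi_2$-reflecting onto $A$ iff for every $\Pi_2$-formula $\varphi(\vec{y})$ (in the language of set theory) and all $\vec{b}\in L_\rho$, if $L_\rho\models\varphi(\vec{b})$, then there exists $\alpha_0<\rho$ with $\alpha_0\in A$, $\vec{b}\in L_{\alpha_0}$ and $L_{\alpha_0}\models\varphi(\vec{b})$. Recursively subtle: $\rho$ is recursively subtle iff for every $\rho$-recursively enumerable $\mathcal{A}\subseteq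 L_\rho$, $\rho$ is $\Pi_2$-reflecting onto the set of $\kappa<\rho$ which are $\mathcal{A}$-$\rho$-stable. *)

theory Defs
  imports "HOL-Library.Countable_Set"
begin

section \<open>A universe of sets\<close>

text \<open>
  The type \<open>'k hset\<close> consists of the pure well-founded sets that have, hereditarily, at most
  as many members as the type \<open>nat + 'k\<close> has elements. It is obtained from well-founded trees by
  identifying trees that denote the same set. Its von Neumann ordinals are the ordinals of
  cardinality at most that of \<open>nat + 'k\<close>, so with \<open>'k\<close> arbitrary every ordinal is covered
  (lemma \<open>ordinal_of_wellorder\<close> below).
\<close>

datatype 'k tree = Empty | Tree "nat + 'k \<Rightarrow> 'k tree"

text \<open>\<open>Tree f\<close> denotes the set of the sets denoted by the trees in the range of \<open>f\<close>.\<close>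

primrec teq :: "'k tree \<Rightarrow> 'k tree \<Rightarrow> bool" where
  "teq Empty t \<longleftrightarrow> t = Empty"
| "teq (Tree f) t \<longleftrightarrow> (case t of Empty \<Rightarrow> False | Tree g \<Rightarrow>
     (\<forall>i. \<exists>j. teq (f i) (g j)) \<and> (\<forall>j. \<exists>i. teq (f i) (g j)))"

lemma teq_refl: "teq t t"
  by (induction t) auto

lemma teq_sym: "teq s t \<Longrightarrow> teq t s"
proof (induction s arbitrary: t)
  case Empty
  then show ?case by simp
next
  case (Tree f)
  then show ?case by (cases t) (simp, simp, meson rangeI)
qed

lemma teq_trans: "teq s t \<Longrightarrow> teq t u \<Longrightarrow> teq s u"
proof (induction s arbitrary: t u)
  case Empty
  then show ?case by simp
next
  case (Tree f)
  obtain g where t: "t = Tree g" using Tree.prems by (cases t) auto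
  obtain h where u: "u = Tree h" using Tree.prems by (cases u) (auto simp: t)
  show ?case
    using Tree.prems Tree.IH[OF rangeI] unfolding t u teq.simps tree.case by meson
qed

quotient_type 'k hset = "'k tree" / teq
  by (rule equivpI) (auto intro: reflpI sympI transpI teq_refl teq_sym teq_trans)

definition elts :: "'k hset \<Rightarrow> 'k hset set" where
  "elts x = (case rep_hset x of Empty \<Rightarrow> {} | Tree f \<Rightarrow> range (\<lambda>i. abs_hset (f i)))"

lemma abs_hset_eq_iff: "abs_hset s = abs_hset t \<longleftrightarrow> teq s t"
  by (simp add: hset.abs_eq_iff)

lemma abs_rep_hset: "abs_hset (rep_hset x) = x"
  by (rule Quotient3_abs_rep[OF Quotient3_hset])

lemma teq_rep_abs: "teq (rep_hset (abs_hset t)) t"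
  by (simp add: abs_hset_eq_iff[symmetric] abs_rep_hset)

lemma elts_Empty: "elts (abs_hset (Empty :: 'k tree)) = {}"
  using teq_sym[OF teq_rep_abs[of "Empty :: 'k tree"]] by (simp add: elts_def)

lemma elts_Tree: "elts (abs_hset (Tree f)) = range (\<lambda>i. abs_hset (f i))"
proof (cases "rep_hset (abs_hset (Tree f))")
  case Empty
  then show ?thesis using teq_sym[OF teq_rep_abs[of "Tree f"]] by simp
next
  case (Tree g)
  then have "teq (Tree g) (Tree f)"
    using teq_rep_abs[of "Tree f"] by simp
  then show ?thesis
    unfolding elts_def Tree tree.case
    by (simp add: image_def set_eq_iff) (metis abs_hset_eq_iff)
qed

lemma hset_cases:
  obtains "x = abs_hset Empty" | f where "x = abs_hset (Tree f)"
  by (metis abs_rep_hset tree.exhaust)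

lemma range_eqD:
  assumes "range F = range G"
  shows "(\<forall>i. \<exists>j. F i = G j) \<and> (\<forall>j. \<exists>i. F i = G j)"
proof (intro conjI allI)
  show "\<exists>j. F i = G j" for i
    using rangeI[of F i] unfolding assms by auto
  show "\<exists>i. F i = G j" for j
    using rangeI[of G j] unfolding assms[symmetric] by (metis imageE)
qed

lemma elts_inject: "elts x = elts y \<longleftrightarrow> x = y"
proof
  assume *: "elts x = elts y"
  show "x = y"
  proof (cases x rule: hset_cases; cases y rule: hset_cases)
    fix f g
    assume xy: "x = abs_hset (Tree f)" "y = abs_hset (Tree g)"
    with * have "range (\<lambda>i. abs_hset (f i)) = range (\<lambda>i. abs_hset (g i))"
      by (simp add: elts_Tree)
    note range_eqD[OF this]
    then have "teq (Tree f) (Tree g)"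
      by (simp add: abs_hset_eq_iff)
    then show "x = y" by (simp add: xy abs_hset_eq_iff)
  qed (use * in \<open>auto simp: elts_Empty elts_Tree\<close>)
qed simp

lemma elts_induct [case_names step]:
  assumes step: "\<And>x. (\<And>y. y \<in> elts x \<Longrightarrow> P y) \<Longrightarrow> P x"
  shows "P x"
proof -
  have "P (abs_hset t)" for t
  proof (induction t)
    case Empty
    show ?case by (rule step) (simp add: elts_Empty)
  next
    case (Tree f)
    show ?case
    proof (rule step)
      fix y
      assume "y \<in> elts (abs_hset (Tree f))"
      then obtain i where "y = abs_hset (f i)" by (auto simp: elts_Tree)
      then show "P y" using Tree[OF rangeI] by simp
    qed
  qed
  from this[of "rep_hset x"] show "P x" by (simp add: abs_rep_hset)
qed

lemma wf_elts: "wf {(x :: 'k hset, y). x \<in> elts y}"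
  unfolding wf_def
proof (intro allI impI)
  fix P :: "'k hset \<Rightarrow> bool" and x :: "'k hset"
  assume "\<forall>x. (\<forall>y. (y, x) \<in> {(x, y). x \<in> elts y} \<longrightarrow> P y) \<longrightarrow> P x"
  then show "P x" by (intro elts_induct[of P x]) simp
qed

definition small :: "'k itself \<Rightarrow> 'a set \<Rightarrow> bool" where
  "small _ D \<longleftrightarrow> (\<exists>f :: nat + 'k \<Rightarrow> 'a. D \<subseteq> range f)"

lemma small_iff_elts: "small TYPE('k) D \<longleftrightarrow> (\<exists>x :: 'k hset. elts x = D)"
proof
  assume "small TYPE('k) D"
  then obtain f :: "nat + 'k \<Rightarrow> 'k hset" where f: "D \<subseteq> range f"
    by (auto simp: small_def)
  show "\<exists>x. elts x = D"
  proof (cases "D = {}")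
    case True
    then show ?thesis using elts_Empty by blast
  next
    case False
    then obtain d where d: "d \<in> D" by blast
    have "elts (abs_hset (Tree (\<lambda>i. rep_hset (if f i \<in> D then f i else d)))) = D"
      unfolding elts_Tree abs_rep_hset using f d by (auto simp: image_iff subset_iff)
    then show ?thesis ..
  qed
next
  assume "\<exists>x :: 'k hset. elts x = D"
  then obtain x :: "'k hset" where x: "elts x = D" ..
  then show "small TYPE('k) D"
    by (cases x rule: hset_cases) (auto simp: small_def elts_Empty elts_Tree)
qed

definition Transset :: "'k hset \<Rightarrow> bool" where
  "Transset x \<longleftrightarrow> (\<forall>y\<in>elts x. elts y \<subseteq> elts x)"

definition Ord :: "'k hset \<Rightarrow> bool" where
  "Ord x \<longleftrightarrow> Transset x \<and> (\<forall>y\<in>elts x. Transset y)"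

lemma ordinal_of_wellorder:
  "\<exists>f :: 'k::wellorder \<Rightarrow> 'k hset. inj f \<and> (\<forall>a. Ord (f a) \<and> elts (f a) = f ` {..<a})"
proof -
  define f :: "'k \<Rightarrow> 'k hset" where
    "f = wfrec {(a, b). a < b} (\<lambda>f a. SOME x. elts x = f ` {..<a})"
  have f: "f a = (SOME x. elts x = f ` {..<a})" for a
    unfolding f_def by (subst wfrec[OF wf]) (simp add: cut_def cong: image_cong_simp)
  have "f ` {..<a} \<subseteq> range (case_sum (\<lambda>_ :: nat. undefined) f)" for a
    by (rule image_subsetI) (simp add: range_eqI[where x = "Inr _"])
  then have "small TYPE('k) (f ` {..<a})" for a
    unfolding small_def by blast
  then have e: "elts (f a) = f ` {..<a}" for a
    by (subst f) (metis (mono_tags, lifting) small_iff_elts someI_ex)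
  have tr: "Transset (f a)" for a
    unfolding Transset_def by (auto simp: e)
  then have ord: "Ord (f a)" for a
    unfolding Ord_def by (auto simp: e)
  have irrefl: "x \<notin> elts x" for x :: "'k hset"
    using wf_irrefl[OF wf_elts] by blast
  have "f a \<noteq> f b" if "a < b" for a b
    using that e[of b] irrefl[of "f b"] by (metis imageI lessThan_iff)
  then have "inj f"
    by (intro injI) (metis linorder_neqE)
  with e ord show ?thesis by blast
qed


section \<open>Formulas and the Levy hierarchy\<close>

text \<open>
  Formulas in the language of set theory with one additional unary predicate symbol.
  Variables are de Bruijn indices: \<open>Ex\<close> binds index \<open>0\<close>.
\<close>

datatype fm = Mem nat nat | Eq nat nat | Pr nat | Neg fm | Conj fm fm | Ex fm

abbreviation Forall :: "fm \<Rightarrow> fm" where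
  "Forall p \<equiv> Neg (Ex (Neg p))"

primrec sat :: "'k hset set \<Rightarrow> 'k hset set \<Rightarrow> fm \<Rightarrow> 'k hset list \<Rightarrow> bool" where
  "sat M A (Mem i j) bs \<longleftrightarrow> bs ! i \<in> elts (bs ! j)"
| "sat M A (Eq i j) bs \<longleftrightarrow> bs ! i = bs ! j"
| "sat M A (Pr i) bs \<longleftrightarrow> bs ! i \<in> A"
| "sat M A (Neg p) bs \<longleftrightarrow> \<not> sat M A p bs"
| "sat M A (Conj p q) bs \<longleftrightarrow> sat M A p bs \<and> sat M A q bs"
| "sat M A (Ex p) bs \<longleftrightarrow> (\<exists>x\<in>M. sat M A p (x # bs))"

text \<open>All free variables of \<open>p\<close> have index below \<open>arity p\<close>.\<close>

primrec arity :: "fm \<Rightarrow> nat" where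
  "arity (Mem i j) = max (Suc i) (Suc j)"
| "arity (Eq i j) = max (Suc i) (Suc j)"
| "arity (Pr i) = Suc i"
| "arity (Neg p) = arity p"
| "arity (Conj p q) = max (arity p) (arity q)"
| "arity (Ex p) = arity p - 1"

primrec pure :: "fm \<Rightarrow> bool" where
  "pure (Mem i j) \<longleftrightarrow> True"
| "pure (Eq i j) \<longleftrightarrow> True"
| "pure (Pr i) \<longleftrightarrow> False"
| "pure (Neg p) \<longleftrightarrow> pure p"
| "pure (Conj p q) \<longleftrightarrow> pure p \<and> pure q"
| "pure (Ex p) \<longleftrightarrow> pure p"

text \<open>
  In rule \<open>BEx\<close> the bound is the variable with index \<open>j\<close> outside the quantifier, hence
  index \<open>Suc j\<close> inside; it is distinct from the quantified variable. Bounded universal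
  quantification is obtained with \<open>Neg\<close>.
\<close>

inductive Delta0 :: "fm \<Rightarrow> bool" where
  Mem: "Delta0 (Mem i j)"
| Eq: "Delta0 (Eq i j)"
| Pr: "Delta0 (Pr i)"
| Neg: "Delta0 p \<Longrightarrow> Delta0 (Neg p)"
| Conj: "Delta0 p \<Longrightarrow> Delta0 q \<Longrightarrow> Delta0 (Conj p q)"
| BEx: "Delta0 p \<Longrightarrow> Delta0 (Ex (Conj (Mem 0 (Suc j)) p))"

text \<open>
  \<open>Sigma_fm n\<close> and \<open>Pi_fm n\<close> are the prenex classes with \<open>n\<close> alternating (possibly empty) blocks
  of unbounded quantifiers in front of a \<open>Delta0\<close> matrix.
\<close>

inductive Sigma_fm :: "nat \<Rightarrow> fm \<Rightarrow> bool" and Pi_fm :: "nat \<Rightarrow> fm \<Rightarrow> bool" where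
  "Delta0 p \<Longrightarrow> Sigma_fm 0 p"
| "Delta0 p \<Longrightarrow> Pi_fm 0 p"
| "Pi_fm n p \<Longrightarrow> Sigma_fm (Suc n) p"
| "Sigma_fm (Suc n) p \<Longrightarrow> Sigma_fm (Suc n) (Ex p)"
| "Sigma_fm n p \<Longrightarrow> Pi_fm (Suc n) p"
| "Pi_fm (Suc n) p \<Longrightarrow> Pi_fm (Suc n) (Forall p)"

text \<open>
  \<open>elementary_wrt F A M N\<close> says that \<open>(M, \<in>, A \<inter> M)\<close> is a substructure of
  \<open>(N, \<in>, A \<inter> N)\<close> that is elementary for the formulas in \<open>F\<close>. Sentences are included
  (\<open>bs = []\<close>), so the empty structure is not elementary in a non-empty one.
\<close>

definition elementary_wrt ::
    "fm set \<Rightarrow> 'k hset set \<Rightarrow> 'k hset set \<Rightarrow> 'k hset set \<Rightarrow> bool" where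
  "elementary_wrt F A M N \<longleftrightarrow> M \<subseteq> N \<and>
     (\<forall>p\<in>F. \<forall>bs\<in>lists M. arity p \<le> length bs \<longrightarrow>
        (sat M (A \<inter> M) p bs \<longleftrightarrow> sat N (A \<inter> N) p bs))"

definition Sigma_elementary :: "nat \<Rightarrow> 'k hset set \<Rightarrow> 'k hset set \<Rightarrow> bool" where
  "Sigma_elementary n M N \<longleftrightarrow> elementary_wrt {p. Sigma_fm n p \<and> pure p} {} M N"


section \<open>The constructible hierarchy\<close>

definition DPow :: "'k hset set \<Rightarrow> 'k hset set set" where
  "DPow M = {{x \<in> M. sat M {} p (x # bs)} | p bs.
     pure p \<and> bs \<in> lists M \<and> arity p \<le> Suc (length bs)}"

text \<open>
  The three clauses of the usual recursion are subsumed by taking the union of \<open>DPow (Lset \<beta>)\<close>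
  over all \<open>\<beta> < \<alpha>\<close>. Each definable subset of \<open>Lset \<beta>\<close> is coded by an element of the type
  \<open>'k hset\<close>, see \<open>DPow_Lset_represented\<close> below.
\<close>

function Lset :: "'k hset \<Rightarrow> 'k hset set" where
  "Lset \<alpha> = {x. \<exists>\<beta>\<in>elts \<alpha>. elts x \<in> DPow (Lset \<beta>)}"
  by auto
termination
  by (relation "{(x, y). x \<in> elts y}") (auto intro: wf_elts)

declare Lset.simps [simp del]

instance fm :: countable
  by countable_datatype

lemma small_UNIV_prod:
  includes cardinal_syntax
  shows "small TYPE('k) (UNIV :: ((nat + 'k) \<times> (nat + 'k)) set)"
proof -
  have "infinite (UNIV :: (nat + 'k) set)"
    using infinite_super[OF subset_UNIV, OF range_inj_infinite[OF inj_Inl]] .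
  then have "|(UNIV :: (nat + 'k) set) \<times> (UNIV :: (nat + 'k) set)| \<le>o |UNIV :: (nat + 'k) set|"
    using card_of_Times_same_infinite ordIso_imp_ordLeq by blast
  then have "\<exists>f :: nat + 'k \<Rightarrow> (nat + 'k) \<times> (nat + 'k). UNIV \<subseteq> range f"
    by (subst (asm) card_of_ordLeq2[symmetric]) auto
  then show ?thesis by (simp add: small_def)
qed

lemma small_image: "small TYPE('k) D \<Longrightarrow> small TYPE('k) (h ` D)"
  unfolding small_def by (metis image_comp image_mono)

lemma small_subset: "small TYPE('k) D \<Longrightarrow> E \<subseteq> D \<Longrightarrow> small TYPE('k) E"
  unfolding small_def by blast

lemma small_Times:
  assumes "small TYPE('k) D" "small TYPE('k) E"
  shows "small TYPE('k) (D \<times> E)"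
proof -
  obtain f g where f: "D \<subseteq> range (f :: nat + 'k \<Rightarrow> _)" and g: "E \<subseteq> range (g :: nat + 'k \<Rightarrow> _)"
    using assms by (auto simp: small_def)
  have "D \<times> E \<subseteq> map_prod f g ` UNIV"
    using f g by (auto simp: image_iff subset_iff)
  then show ?thesis
    using small_subset small_image small_UNIV_prod by blast
qed

lemma small_UN:
  assumes I: "small TYPE('k) I" and D: "\<And>i. i \<in> I \<Longrightarrow> small TYPE('k) (D i)"
  shows "small TYPE('k) (\<Union>i\<in>I. D i)"
proof -
  have "\<forall>i\<in>I. \<exists>f. D i \<subseteq> range (f :: nat + 'k \<Rightarrow> _)"
    using D by (auto simp: small_def)
  then obtain f where f: "\<And>i. i \<in> I \<Longrightarrow> D i \<subseteq> range (f i :: nat + 'k \<Rightarrow> _)"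
    by metis
  have "small TYPE('k) (UNIV :: (nat + 'k) set)"
    unfolding small_def by (rule exI[of _ id]) simp
  then have "small TYPE('k) ((\<lambda>(i, k). f i k) ` (I \<times> UNIV))"
    by (intro small_image small_Times I)
  then show ?thesis
    by (rule small_subset) (use f in fastforce)
qed

lemma small_countable: "countable D \<Longrightarrow> small TYPE('k) D"
proof -
  assume "countable D"
  then have "D \<subseteq> range (\<lambda>k :: nat + 'k. case k of Inl n \<Rightarrow> from_nat_into D n | Inr _ \<Rightarrow> undefined)"
    by (auto simp: image_iff) (metis from_nat_into_surj old.sum.simps(5))
  then show ?thesis unfolding small_def by blast
qed

lemma small_lists:
  assumes "small TYPE('k) D"
  shows "small TYPE('k) (lists D)"
proof -
  have n: "small TYPE('k) {bs \<in> lists D. length bs = n}" for n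
  proof (induction n)
    case 0
    have "{bs \<in> lists D. length bs = 0} = {[]}" by auto
    then show ?case by (simp add: small_countable)
  next
    case (Suc n)
    have "{bs \<in> lists D. length bs = Suc n} \<subseteq>
        (\<lambda>(b, bs). b # bs) ` (D \<times> {bs \<in> lists D. length bs = n})"
      by (auto simp: length_Suc_conv image_iff)
    then show ?case
      by (rule small_subset[rotated]) (intro small_image small_Times assms Suc)
  qed
  have "small TYPE('k) (\<Union>n. {bs \<in> lists D. length bs = n})"
    by (rule small_UN) (auto intro: small_countable n)
  then show ?thesis by (rule small_subset) auto
qed

lemma small_DPow: "small TYPE('k) M \<Longrightarrow> small TYPE('k) (DPow M)"
proof -
  assume "small TYPE('k) M"
  then have "small TYPE('k) ((\<lambda>(p, bs). {x \<in> M. sat M {} p (x # bs)}) ` (UNIV \<times> lists M))"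
    by (intro small_image small_Times small_lists small_countable[OF countableI_type])
  then show ?thesis by (rule small_subset) (auto simp: DPow_def image_iff)
qed

lemma small_Lset: "small TYPE('k) (Lset (\<alpha> :: 'k hset))"
proof (induction \<alpha> rule: elts_induct)
  case (step \<alpha>)
  have "small TYPE('k) (\<Union>\<beta>\<in>elts \<alpha>. DPow (Lset \<beta>))"
    by (rule small_UN) (auto simp: small_iff_elts intro: small_DPow step)
  then have "small TYPE('k) (inv elts ` (\<Union>\<beta>\<in>elts \<alpha>. DPow (Lset \<beta>)))"
    by (rule small_image)
  moreover have "Lset \<alpha> \<subseteq> inv elts ` (\<Union>\<beta>\<in>elts \<alpha>. DPow (Lset \<beta>))"
  proof
    fix x
    assume "x \<in> Lset \<alpha>"
    then have "elts x \<in> (\<Union>\<beta>\<in>elts \<alpha>. DPow (Lset \<beta>))"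
      by (subst (asm) Lset.simps) blast
    moreover have "inv elts (elts x) = x"
      by (simp add: inj_def elts_inject)
    ultimately show "x \<in> inv elts ` (\<Union>\<beta>\<in>elts \<alpha>. DPow (Lset \<beta>))"
      by (metis imageI)
  qed
  ultimately show ?case by (rule small_subset)
qed

lemma DPow_Lset_represented: "D \<in> DPow (Lset \<beta>) \<Longrightarrow> \<exists>x. elts x = D"
  by (subst small_iff_elts[symmetric], rule small_subset[OF small_Lset])
     (auto simp: DPow_def)


section \<open>Nonprojectibility, stability and recursive subtlety\<close>

definition Sigma2_nonprojectible :: "'k hset \<Rightarrow> bool" where
  "Sigma2_nonprojectible \<rho> \<longleftrightarrow>
     (\<forall>\<beta>\<in>elts \<rho>. \<exists>\<eta>\<in>elts \<rho>. elts \<beta> \<subseteq> elts \<eta> \<and> Sigma_elementary 2 (Lset \<eta>) (Lset \<rho>))"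

definition rec_enumerable :: "'k hset \<Rightarrow> 'k hset set \<Rightarrow> bool" where
  "rec_enumerable \<rho> A \<longleftrightarrow>
     (\<exists>p bs. Sigma_fm 1 p \<and> pure p \<and> bs \<in> lists (Lset \<rho>) \<and> arity p \<le> Suc (length bs) \<and>
        A = {x \<in> Lset \<rho>. sat (Lset \<rho>) {} p (x # bs)})"

definition stable :: "'k hset set \<Rightarrow> 'k hset \<Rightarrow> 'k hset \<Rightarrow> bool" where
  "stable A \<rho> \<kappa> \<longleftrightarrow> elementary_wrt {p. Sigma_fm 1 p} A (Lset \<kappa>) (Lset \<rho>)"

text \<open>
  The parameter tuple is taken to be non-empty; sentences are covered since a formula need
  not mention all its parameters. This only excludes the empty structure \<open>Lset 0\<close>: for
  \<open>\<rho> = 0\<close> the condition is vacuous, and a reflecting \<open>\<alpha>\<close> is never \<open>0\<close>.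
\<close>

definition Pi2_reflecting_onto :: "'k hset \<Rightarrow> 'k hset set \<Rightarrow> bool" where
  "Pi2_reflecting_onto \<rho> A \<longleftrightarrow>
     (\<forall>p bs. Pi_fm 2 p \<and> pure p \<and> bs \<noteq> [] \<and> bs \<in> lists (Lset \<rho>) \<and> arity p \<le> length bs \<and>
        sat (Lset \<rho>) {} p bs \<longrightarrow>
        (\<exists>\<alpha>\<in>elts \<rho>. \<alpha> \<in> A \<and> bs \<in> lists (Lset \<alpha>) \<and> sat (Lset \<alpha>) {} p bs))"

definition recursively_subtle :: "'k hset \<Rightarrow> bool" where
  "recursively_subtle \<rho> \<longleftrightarrow>
     (\<forall>A \<subseteq> Lset \<rho>. rec_enumerable \<rho> A \<longrightarrow>
        Pi2_reflecting_onto \<rho> {\<kappa> \<in> elts \<rho>. stable A \<rho> \<kappa>})"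

end

theory Submission
  imports Defs
begin

text \<open>
  In both directions the point is to compare truth of \<open>\<Sigma>\<^sub>2\<close> formulas with truth of \<open>\<Sigma>\<^sub>1\<close> formulas
  that mention a recursively enumerable class.

  Let \<open>\<rho>\<close> be \<open>\<Sigma>\<^sub>2\<close>-nonprojectible and let \<open>A\<close> be defined over \<open>L\<^sub>\<rho>\<close> by a \<open>\<Sigma>\<^sub>1\<close> formula \<open>\<psi>\<close> with
  parameters \<open>a\<close>. Choose \<open>\<eta> < \<rho>\<close> with \<open>L\<^sub>\<eta>\<close> \<open>\<Sigma>\<^sub>2\<close>-elementary in \<open>L\<^sub>\<rho>\<close> and containing all parameters; then
  \<open>\<Pi>\<^sub>2\<close> facts pass down to \<open>L\<^sub>\<eta>\<close>, and only stability needs an argument. A \<open>\<Sigma>\<^sub>1(A)\<close> fact about \<open>c\<close>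
  that holds in \<open>L\<^sub>\<rho>\<close> already holds in some \<open>\<Sigma>\<^sub>2\<close>-elementary \<open>L\<^sub>\<mu>\<close>, \<open>\<eta> \<le> \<mu> < \<rho>\<close>, and there \<open>\<psi>\<close> defines
  \<open>A \<inter> L\<^sub>\<mu>\<close>. So \<open>L\<^sub>\<rho>\<close> satisfies the \<open>\<Sigma>\<^sub>2\<close> statement "there is a transitive \<open>z\<close> containing \<open>c\<close> and \<open>a\<close>
  in which the fact holds when \<open>A\<close> is read as \<open>{u. z \<Turnstile> \<psi>(u, a)}\<close>, and \<open>z\<close> decides \<open>\<psi>\<close> correctly on
  its members". Here correctness of \<open>z\<close> is \<open>\<Pi>\<^sub>1\<close>: it compares \<open>z\<close> with every transitive set \<open>t\<close>.
  A witness \<open>z \<in> L\<^sub>\<eta>\<close> gives the fact in \<open>L\<^sub>\<eta>\<close> (lemma \<open>Sigma2_elementary_stable\<close>).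

  Conversely let \<open>\<rho>\<close> be recursively subtle. There is one recursively enumerable class \<open>universal \<rho>\<close>
  that decides all \<open>\<Sigma>\<^sub>1\<close> statements with parameters: it consists of the positions (a coded formula
  together with an assignment) that lie in a transitive set \<open>z\<close> and in a Hintikka set \<open>s\<close> for
  \<open>z\<close>. A Hintikka set is a set of positions, each of which is supported by others as the meaning of
  its outermost connective requires; membership in one therefore certifies truth in \<open>z\<close>
  (\<open>hintikka_sound\<close>), and every truth in a level \<open>L\<^sub>\<kappa>\<close> with \<open>\<kappa> < \<rho>\<close> is certified by a Hintikka set
  in \<open>L\<^sub>\<rho>\<close> (\<open>hintikka_complete\<close>). A \<open>\<Sigma>\<^sub>2\<close> formula becomes \<open>\<Sigma>\<^sub>1\<close> over this class, since its \<open>\<Pi>\<^sub>1\<close> kernel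
  says that a certain position is outside \<open>universal \<rho>\<close>. Hence levels stable for
  \<open>universal \<rho>\<close> are \<open>\<Sigma>\<^sub>2\<close>-elementary (\<open>stable_universal_Sigma2_elementary\<close>), and reflecting a
  trivial formula with the parameter \<open>L\<^sub>\<beta>\<close> yields such a level beyond \<open>\<beta>\<close>.
\<close>

section \<open>Ordinals and levels of the constructible hierarchy\<close>

lemma elts_irrefl: "x \<notin> elts (x :: 'k hset)"
  using wf_irrefl[OF wf_elts] by blast

lemma Ord_elt: "Ord \<alpha> \<Longrightarrow> \<beta> \<in> elts \<alpha> \<Longrightarrow> Ord \<beta>"
  unfolding Ord_def Transset_def by blast

lemma Ord_trans: "Ord \<alpha> \<Longrightarrow> \<beta> \<in> elts \<alpha> \<Longrightarrow> elts \<beta> \<subseteq> elts \<alpha>"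
  unfolding Ord_def Transset_def by blast

lemma Ord_linear: "Ord \<alpha> \<Longrightarrow> Ord \<beta> \<Longrightarrow> \<alpha> \<in> elts \<beta> \<or> \<alpha> = \<beta> \<or> \<beta> \<in> elts \<alpha>"
proof (induction \<alpha> arbitrary: \<beta> rule: elts_induct)
  case (step \<alpha>)
  note outer = step
  from \<open>Ord \<beta>\<close> show ?case
  proof (induction \<beta> rule: elts_induct)
    case (step \<beta>)
    show ?case
    proof (rule ccontr)
      assume *: "\<not> ?case"
      have "elts \<alpha> \<subseteq> elts \<beta>"
      proof
        fix \<gamma> assume \<gamma>: "\<gamma> \<in> elts \<alpha>"
        then have "\<gamma> \<in> elts \<beta> \<or> \<gamma> = \<beta> \<or> \<beta> \<in> elts \<gamma>"
          using outer(1)[OF \<gamma> Ord_elt[OF outer(2) \<gamma>] step(2)] by simp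
        then show "\<gamma> \<in> elts \<beta>" using * \<gamma> Ord_trans[OF outer(2) \<gamma>] by blast
      qed
      moreover have "elts \<beta> \<subseteq> elts \<alpha>"
      proof
        fix \<gamma> assume \<gamma>: "\<gamma> \<in> elts \<beta>"
        then have "\<alpha> \<in> elts \<gamma> \<or> \<alpha> = \<gamma> \<or> \<gamma> \<in> elts \<alpha>"
          using step(1)[OF \<gamma> Ord_elt[OF step(2) \<gamma>]] by simp
        then show "\<gamma> \<in> elts \<alpha>" using * \<gamma> Ord_trans[OF step(2) \<gamma>] by blast
      qed
      ultimately show False using * elts_inject by blast
    qed
  qed
qed

definition transitive :: "'k hset set \<Rightarrow> bool" where
  "transitive M \<longleftrightarrow> (\<forall>x\<in>M. elts x \<subseteq> M)"

lemma transitiveD: "transitive M \<Longrightarrow> x \<in> M \<Longrightarrow> y \<in> elts x \<Longrightarrow> y \<in> M"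
  unfolding transitive_def by blast

lemma Lset_iff: "x \<in> Lset \<alpha> \<longleftrightarrow> (\<exists>\<beta>\<in>elts \<alpha>. elts x \<in> DPow (Lset \<beta>))"
  by (subst Lset.simps) simp

lemma DPow_subset: "D \<in> DPow M \<Longrightarrow> D \<subseteq> M"
  unfolding DPow_def by auto

lemma DPow_self: "M \<in> DPow M"
  unfolding DPow_def by (rule CollectI, intro exI[of _ "Eq 0 0"] exI[of _ "[]"]) auto

lemma transitive_DPow:
  assumes "transitive M" "x \<in> M"
  shows "elts x \<in> DPow M"
  using assms unfolding DPow_def transitive_def
  by (intro CollectI exI[of _ "Mem 0 1"] exI[of _ "[x]"]) auto

lemma transitive_Lset: "transitive (Lset \<alpha>)"
proof (induction \<alpha> rule: elts_induct)
  case (step \<alpha>)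
  show ?case
    unfolding transitive_def
  proof (intro ballI subsetI)
    fix x y assume "x \<in> Lset \<alpha>" "y \<in> elts x"
    then obtain \<beta> where \<beta>: "\<beta> \<in> elts \<alpha>" "elts x \<in> DPow (Lset \<beta>)"
      unfolding Lset_iff[of x] by blast
    then have "y \<in> Lset \<beta>" using DPow_subset \<open>y \<in> elts x\<close> by blast
    then have "elts y \<in> DPow (Lset \<beta>)" using step[OF \<beta>(1)] by (intro transitive_DPow)
    then show "y \<in> Lset \<alpha>" unfolding Lset_iff[of y] using \<beta>(1) by (rule rev_bexI[rotated])
  qed
qed

lemma Lset_mono: "elts \<alpha> \<subseteq> elts \<beta> \<Longrightarrow> Lset \<alpha> \<subseteq> Lset \<beta>"
  unfolding subset_iff Lset_iff[of _ \<alpha>] Lset_iff[of _ \<beta>] by blast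

lemma Lset_elt_subset: "\<beta> \<in> elts \<alpha> \<Longrightarrow> Lset \<beta> \<subseteq> Lset \<alpha>"
  by (auto simp: Lset_iff[of _ \<alpha>] intro!: bexI[of _ \<beta>] transitive_DPow[OF transitive_Lset])

text \<open>
  The set with a prescribed collection of members, meaningful when that collection is small. It turns
  the level \<open>Lset \<alpha>\<close>, a collection, into an object that formulas can speak about.
\<close>

definition mk :: "'k hset set \<Rightarrow> 'k hset" where
  "mk D = inv elts D"

lemma mk_elts: "mk (elts x) = x"
  unfolding mk_def by (simp add: inj_def elts_inject)

lemma elts_mk: "small TYPE('k) D \<Longrightarrow> elts (mk D :: 'k hset) = D"
  using mk_elts by (metis small_iff_elts)

lemma elts_mk_finite: "finite D \<Longrightarrow> elts (mk D) = D"
  by (simp add: elts_mk small_countable countable_finite)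

lemma elts_mk_Lset: "elts (mk (Lset \<alpha>)) = Lset \<alpha>"
  by (simp add: elts_mk small_Lset)

lemma mk_Lset_in: "\<beta> \<in> elts \<alpha> \<Longrightarrow> mk (Lset \<beta>) \<in> Lset \<alpha>"
  unfolding Lset_iff[of _ \<alpha>] elts_mk_Lset using DPow_self by (rule bexI)

text \<open>
  Levels serve in place of ordinals as parameters: a level that contains \<open>L\<^sub>\<eta>\<close> as an element cannot be
  included in \<open>L\<^sub>\<eta>\<close>, by well-foundedness, so its index exceeds that of every level included in \<open>L\<^sub>\<eta>\<close>.
\<close>

lemma mk_Lset_inD:
  assumes "Ord \<alpha>" "Ord \<beta>" "Lset \<beta> \<subseteq> Lset \<eta>" "mk (Lset \<eta>) \<in> Lset \<alpha>"
  shows "\<beta> \<in> elts \<alpha>"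
proof (rule ccontr)
  assume "\<beta> \<notin> elts \<alpha>"
  then have "Lset \<alpha> \<subseteq> Lset \<beta>"
    using Ord_linear[OF assms(1,2)] Lset_elt_subset by blast
  then have "mk (Lset \<eta>) \<in> elts (mk (Lset \<eta>))"
    using assms by (auto simp: elts_mk_Lset)
  then show False using elts_irrefl by blast
qed

text \<open>
  For an ordinal \<open>\<rho> \<noteq> 0\<close> this says that \<open>\<rho>\<close> is a limit.
\<close>

definition exhausted :: "'k hset \<Rightarrow> bool" where
  "exhausted \<rho> \<longleftrightarrow> (\<forall>b\<in>Lset \<rho>. \<exists>\<kappa>\<in>elts \<rho>. b \<in> Lset \<kappa>)"

lemma Lset_chain:
  assumes "Ord \<rho>" "\<alpha> \<in> elts \<rho>" "\<beta> \<in> elts \<rho>"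
  shows "\<exists>\<gamma>\<in>elts \<rho>. Lset \<alpha> \<subseteq> Lset \<gamma> \<and> Lset \<beta> \<subseteq> Lset \<gamma>"
  using Ord_linear[of \<alpha> \<beta>] Ord_elt[OF assms(1)] assms(2,3) Lset_elt_subset by blast

lemma exhausted_list:
  assumes "Ord \<rho>" "exhausted \<rho>" "\<beta> \<in> elts \<rho>" "bs \<in> lists (Lset \<rho>)"
  shows "\<exists>\<kappa>\<in>elts \<rho>. Lset \<beta> \<subseteq> Lset \<kappa> \<and> bs \<in> lists (Lset \<kappa>)"
  using assms(4)
proof (induction bs)
  case Nil
  then show ?case using assms(3) by auto
next
  case (Cons b bs)
  then obtain \<kappa> where \<kappa>: "\<kappa> \<in> elts \<rho>" "Lset \<beta> \<subseteq> Lset \<kappa>" "bs \<in> lists (Lset \<kappa>)" by blast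
  obtain \<mu> where \<mu>: "\<mu> \<in> elts \<rho>" "b \<in> Lset \<mu>"
    using assms(2) Cons unfolding exhausted_def by blast
  obtain \<gamma> where "\<gamma> \<in> elts \<rho>" "Lset \<kappa> \<subseteq> Lset \<gamma>" "Lset \<mu> \<subseteq> Lset \<gamma>"
    using Lset_chain[OF assms(1) \<kappa>(1) \<mu>(1)] by blast
  then show ?case using \<kappa> \<mu> lists_mono[of "Lset \<kappa>" "Lset \<gamma>"] by (intro bexI[of _ \<gamma>]) auto
qed

section \<open>Absoluteness and persistence along levels\<close>

lemma sat_cong_predicate:
  assumes "\<And>x. x \<in> M \<Longrightarrow> x \<in> A \<longleftrightarrow> x \<in> B"
  shows "bs \<in> lists M \<Longrightarrow> arity p \<le> length bs \<Longrightarrow> sat M A p bs \<longleftrightarrow> sat M B p bs"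
proof (induction p arbitrary: bs)
  case (Pr i)
  then show ?case using assms by auto
next
  case (Ex p)
  then have "sat M A p (x # bs) \<longleftrightarrow> sat M B p (x # bs)" if "x \<in> M" for x
    using that by (intro Ex.IH) auto
  then show ?case by auto
qed auto

lemma sat_pure: "pure p \<Longrightarrow> sat M A p bs \<longleftrightarrow> sat M B p bs"
  by (induction p arbitrary: bs) auto

text \<open>
  The prenex classes are not closed under negation literally, because negation has to be pushed
  through the quantifier prefix; up to equivalence it exchanges the two hierarchies.
\<close>

lemma dual_formula:
  "Sigma_fm n p \<Longrightarrow> \<exists>q. Pi_fm n q \<and> arity q = arity p \<and> pure q = pure p \<and>
     (\<forall>(M :: 'k hset set) A bs. sat M A q bs \<longleftrightarrow> \<not> sat M A p bs)"
  "Pi_fm n p \<Longrightarrow> \<exists>q. Sigma_fm n q \<and> arity q = arity p \<and> pure q = pure p \<and>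
     (\<forall>(M :: 'k hset set) A bs. sat M A q bs \<longleftrightarrow> \<not> sat M A p bs)"
proof (induction rule: Sigma_fm_Pi_fm.inducts)
  case (1 p)
  then show ?case by (intro exI[of _ "Neg p"]) (auto intro: Sigma_fm_Pi_fm.intros Delta0.intros)
next
  case (2 p)
  then show ?case by (intro exI[of _ "Neg p"]) (auto intro: Sigma_fm_Pi_fm.intros Delta0.intros)
next
  case (3 n p)
  then show ?case using Sigma_fm_Pi_fm.intros(5) by blast
next
  case (4 n p)
  then obtain q where "Pi_fm (Suc n) q" "arity q = arity p" "pure q = pure p"
    "\<forall>(M :: 'k hset set) A bs. sat M A q bs \<longleftrightarrow> \<not> sat M A p bs" by blast
  then show ?case by (intro exI[of _ "Forall q"]) (auto intro: Sigma_fm_Pi_fm.intros)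
next
  case (5 n p)
  then show ?case using Sigma_fm_Pi_fm.intros(3) by blast
next
  case (6 n p)
  then obtain q where "Sigma_fm (Suc n) q" "arity q = arity p" "pure q = pure p"
    "\<forall>(M :: 'k hset set) A bs. sat M A q bs \<longleftrightarrow> \<not> sat M A p bs" by blast
  then show ?case by (intro exI[of _ "Ex q"]) (auto intro: Sigma_fm_Pi_fm.intros)
qed

lemma Pi_fm_0: "Pi_fm 0 p \<Longrightarrow> Delta0 p"
  by (auto elim: Pi_fm.cases)

lemma Sigma_fm_1_induct [consumes 1, case_names Delta0 Ex]:
  assumes "Sigma_fm (Suc 0) p"
    and "\<And>p. Delta0 p \<Longrightarrow> P p"
    and "\<And>p. Sigma_fm (Suc 0) p \<Longrightarrow> P p \<Longrightarrow> P (Ex p)"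
  shows "P p"
proof -
  have "(Sigma_fm n p \<longrightarrow> n = Suc 0 \<longrightarrow> P p) \<and> (Pi_fm n p \<longrightarrow> True)" for n p
    by (induction n p rule: Sigma_fm_Pi_fm.induct) (auto intro: assms(2,3) dest: Pi_fm_0)
  then show ?thesis using assms(1) by blast
qed

lemma Sigma_fm_2_induct [consumes 1, case_names Pi1 Ex]:
  assumes "Sigma_fm 2 p"
    and "\<And>p. Pi_fm 1 p \<Longrightarrow> P p"
    and "\<And>p. Sigma_fm 2 p \<Longrightarrow> P p \<Longrightarrow> P (Ex p)"
  shows "P p"
proof -
  have "(Sigma_fm n p \<longrightarrow> n = 2 \<longrightarrow> P p) \<and> (Pi_fm n p \<longrightarrow> True)" for n p
    by (induction n p rule: Sigma_fm_Pi_fm.induct) (auto intro: assms(2,3) simp: numeral_2_eq_2)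
  then show ?thesis using assms(1) by blast
qed

lemma Sigma_fm_1_2: "Sigma_fm (Suc 0) p \<Longrightarrow> Sigma_fm 2 p"
  by (induction rule: Sigma_fm_1_induct)
     (auto simp: numeral_2_eq_2 intro: Sigma_fm_Pi_fm.intros)

lemma Delta0_absolute:
  assumes "Delta0 p" "transitive M" "transitive N" "M \<subseteq> N" "bs \<in> lists M" "arity p \<le> length bs"
  shows "sat M (A \<inter> M) p bs \<longleftrightarrow> sat N (A \<inter> N) p bs"
  using assms(1,5,6)
proof (induction p arbitrary: bs)
  case (Pr i)
  then have "bs ! i \<in> M" by auto
  then show ?case using assms(4) by auto
next
  case (BEx p j)
  then have bj: "bs ! j \<in> M" by auto
  have "x \<in> M" if "x \<in> elts (bs ! j)" for x
    using bj that assms(2) transitiveD by blast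
  moreover have "sat M (A \<inter> M) p (x # bs) \<longleftrightarrow> sat N (A \<inter> N) p (x # bs)" if "x \<in> M" for x
    using that BEx.prems by (intro BEx.IH) auto
  ultimately show ?case using assms(4) by auto
qed auto

lemma Sigma1_persistent:
  assumes "Sigma_fm (Suc 0) p" "transitive M" "transitive N" "M \<subseteq> N" "bs \<in> lists M"
    "arity p \<le> length bs" "sat M (A \<inter> M) p bs"
  shows "sat N (A \<inter> N) p bs"
  using assms(1,5-)
proof (induction p arbitrary: bs rule: Sigma_fm_1_induct)
  case (Delta0 p)
  then show ?case using Delta0_absolute[OF Delta0(1) assms(2-4) Delta0(2,3)] by simp
next
  case (Ex p)
  then obtain x where x: "x \<in> M" "sat M (A \<inter> M) p (x # bs)" by auto
  then have "sat N (A \<inter> N) p (x # bs)" using Ex.prems by (intro Ex.IH) auto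
  then show ?case using x assms(4) by auto
qed

text \<open>
  Finitely many witnesses for the existential quantifiers all appear at some level below \<open>\<rho>\<close>, and the
  \<open>\<Delta>\<^sub>0\<close> matrix is absolute between that level and \<open>L\<^sub>\<rho>\<close>.
\<close>

lemma Sigma1_reflects:
  assumes "Sigma_fm (Suc 0) p" "Ord \<rho>" "exhausted \<rho>" "\<beta> \<in> elts \<rho>" "bs \<in> lists (Lset \<rho>)"
    "arity p \<le> length bs" "sat (Lset \<rho>) (A \<inter> Lset \<rho>) p bs"
  shows "\<exists>\<kappa>\<in>elts \<rho>. Lset \<beta> \<subseteq> Lset \<kappa> \<and> bs \<in> lists (Lset \<kappa>) \<and> sat (Lset \<kappa>) (A \<inter> Lset \<kappa>) p bs"
  using assms(1,5-)
proof (induction p arbitrary: bs rule: Sigma_fm_1_induct)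
  case (Delta0 p)
  then obtain \<kappa> where \<kappa>: "\<kappa> \<in> elts \<rho>" "Lset \<beta> \<subseteq> Lset \<kappa>" "bs \<in> lists (Lset \<kappa>)"
    using exhausted_list[OF assms(2-4)] by blast
  with Delta0 Delta0_absolute[OF Delta0(1) transitive_Lset transitive_Lset Lset_elt_subset[OF \<kappa>(1)] \<kappa>(3)]
  show ?case by auto
next
  case (Ex p)
  then obtain x where x: "x \<in> Lset \<rho>" "sat (Lset \<rho>) (A \<inter> Lset \<rho>) p (x # bs)" by auto
  have "\<exists>\<kappa>\<in>elts \<rho>. Lset \<beta> \<subseteq> Lset \<kappa> \<and> x # bs \<in> lists (Lset \<kappa>) \<and>
      sat (Lset \<kappa>) (A \<inter> Lset \<kappa>) p (x # bs)"
    by (rule Ex.IH) (use x Ex.prems in auto)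
  then show ?case by auto
qed

section \<open>Relations that are uniformly \<open>\<Delta>\<^sub>0\<close> on transitive sets\<close>

text \<open>
  De Bruijn formulas are hard to write and read. So a relation between sets, given as a predicate on
  assignments of length \<open>m\<close>, is only shown to be expressible by one pure \<open>\<Delta>\<^sub>0\<close> formula whose meaning is
  the same in every transitive structure. The closure rules below build such predicates
  from the outside in; passing a quantifier turns \<open>x\<close> into \<open>hd e\<close> and any older \<open>v e\<close> into
  \<open>v (tl e)\<close>.
\<close>

definition D0 :: "nat \<Rightarrow> ('k hset list \<Rightarrow> bool) \<Rightarrow> bool" where
  "D0 m P \<longleftrightarrow> (\<exists>p. Delta0 p \<and> pure p \<and> arity p \<le> m \<and>
     (\<forall>M A bs. transitive M \<and> bs \<in> lists M \<and> length bs = m \<longrightarrow> (sat M A p bs \<longleftrightarrow> P bs)))"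

text \<open>
  Only the values on assignments of length \<open>m\<close> matter, so that a coordinate may be given in any
  convenient form, such as \<open>hd\<close>, \<open>v \<circ> tl\<close> or a member of a segment of the assignment.
\<close>

definition isvar :: "nat \<Rightarrow> ('k hset list \<Rightarrow> 'k hset) \<Rightarrow> bool" where
  "isvar m v \<longleftrightarrow> (\<exists>i<m. \<forall>e. length e = m \<longrightarrow> v e = e ! i)"

definition isvars :: "nat \<Rightarrow> nat \<Rightarrow> ('k hset list \<Rightarrow> 'k hset list) \<Rightarrow> bool" where
  "isvars m n L \<longleftrightarrow> (\<forall>e. length e = m \<longrightarrow> length (L e) = n) \<and> (\<forall>i<n. isvar m (\<lambda>e. L e ! i))"

lemma isvar_nth: "i < m \<Longrightarrow> isvar m (\<lambda>e. e ! i)"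
  unfolding isvar_def by blast

lemma isvar_hd: "isvar (Suc m) hd"
  unfolding isvar_def by (intro exI[of _ 0]) (auto simp: length_Suc_conv)

lemma isvar_tl:
  assumes "isvar m v"
  shows "isvar (Suc m) (\<lambda>e. v (tl e))"
proof -
  obtain i where i: "i < m" "\<And>e. length e = m \<Longrightarrow> v e = e ! i"
    using assms unfolding isvar_def by blast
  have "v (tl e) = e ! Suc i" if "length e = Suc m" for e
    using that i by (simp add: nth_tl)
  then show ?thesis using i(1) unfolding isvar_def by (intro exI[of _ "Suc i"]) simp
qed

lemma isvar_cong: "isvar m u \<Longrightarrow> (\<And>e. length e = m \<Longrightarrow> u e = v e) \<Longrightarrow> isvar m v"
  unfolding isvar_def by auto

lemma isvars_nth: "isvars m n L \<Longrightarrow> i < n \<Longrightarrow> isvar m (\<lambda>e. L e ! i)"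
  unfolding isvars_def by blast

lemma isvars_length: "isvars m n L \<Longrightarrow> length e = m \<Longrightarrow> length (L e) = n"
  unfolding isvars_def by blast

lemma isvars_Cons:
  assumes "isvar m v" "isvars m n L"
  shows "isvars m (Suc n) (\<lambda>e. v e # L e)"
  unfolding isvars_def
proof (intro conjI allI impI)
  fix i assume "i < Suc n"
  then show "isvar m (\<lambda>e. (v e # L e) ! i)"
    using assms isvars_nth by (cases i) auto
qed (simp add: isvars_length[OF assms(2)])

lemma isvars_tail:
  assumes "isvars m (Suc n) L"
  shows "isvars m n (\<lambda>e. tl (L e))"
  unfolding isvars_def
proof (intro conjI allI impI)
  fix i assume i: "i < n"
  show "isvar m (\<lambda>e. tl (L e) ! i)"
    by (rule isvar_cong[OF isvars_nth[OF assms, of "Suc i"]])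
       (use i in \<open>simp_all add: nth_tl isvars_length[OF assms]\<close>)
qed (simp add: isvars_length[OF assms])

lemma isvars_tl: "isvars m n L \<Longrightarrow> isvars (Suc m) n (\<lambda>e. L (tl e))"
  unfolding isvars_def by (auto intro: isvar_tl[of _ "\<lambda>e. L e ! _"])

lemma isvars_segment: "k + n \<le> m \<Longrightarrow> isvars m n (\<lambda>e. take n (drop k e))"
  unfolding isvars_def isvar_def by (auto intro!: exI[of _ "k + _"])

lemma D0_cong:
  assumes "D0 m P" "\<And>e. length e = m \<Longrightarrow> P e \<longleftrightarrow> Q e"
  shows "D0 m Q"
  using assms unfolding D0_def by (metis (no_types, lifting))

lemma D0_Mem: "isvar m u \<Longrightarrow> isvar m v \<Longrightarrow> D0 m (\<lambda>e. u e \<in> elts (v e))"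
  unfolding isvar_def D0_def
  apply clarify
  subgoal for i j by (rule exI[of _ "Mem i j"]) (auto intro: Delta0.intros)
  done

lemma D0_Eq: "isvar m u \<Longrightarrow> isvar m v \<Longrightarrow> D0 m (\<lambda>e. u e = v e)"
  unfolding isvar_def D0_def
  apply clarify
  subgoal for i j by (rule exI[of _ "Eq i j"]) (auto intro: Delta0.intros)
  done

lemma D0_Not: "D0 m P \<Longrightarrow> D0 m (\<lambda>e. \<not> P e)"
  unfolding D0_def
  apply clarify
  subgoal for p by (rule exI[of _ "Neg p"]) (auto intro: Delta0.intros)
  done

lemma D0_And: "D0 m P \<Longrightarrow> D0 m Q \<Longrightarrow> D0 m (\<lambda>e. P e \<and> Q e)"
  unfolding D0_def
  apply clarify
  subgoal for p q by (rule exI[of _ "Conj p q"]) (auto intro: Delta0.intros)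
  done

lemma D0_Or: "D0 m P \<Longrightarrow> D0 m Q \<Longrightarrow> D0 m (\<lambda>e. P e \<or> Q e)"
  using D0_Not[OF D0_And[OF D0_Not D0_Not]] by (rule D0_cong) auto

lemma D0_Imp: "D0 m P \<Longrightarrow> D0 m Q \<Longrightarrow> D0 m (\<lambda>e. P e \<longrightarrow> Q e)"
  using D0_Or[OF D0_Not] by (rule D0_cong) auto

lemma D0_BEx:
  assumes "isvar m v" and "D0 (Suc m) (\<lambda>e. Q (hd e) (tl e))"
  shows "D0 m (\<lambda>e. \<exists>x\<in>elts (v e). Q x e)"
proof -
  obtain j where j: "j < m" "\<And>e. length e = m \<Longrightarrow> v e = e ! j"
    using assms(1) unfolding isvar_def by blast
  obtain p where p: "Delta0 p" "pure p" "arity p \<le> Suc m"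
    "\<And>M A bs. transitive M \<Longrightarrow> bs \<in> lists M \<Longrightarrow> length bs = Suc m \<Longrightarrow> sat M A p bs \<longleftrightarrow> Q (hd bs) (tl bs)"
    using assms(2) unfolding D0_def by blast
  have "sat M A (Ex (Conj (Mem 0 (Suc j)) p)) bs \<longleftrightarrow> (\<exists>x\<in>elts (v bs). Q x bs)"
    if "transitive M" "bs \<in> lists M" "length bs = m" for M A bs
  proof -
    have "bs ! j \<in> M" using that j by auto
    then have "x \<in> M" if "x \<in> elts (bs ! j)" for x
      using that \<open>transitive M\<close> transitiveD by blast
    moreover have "sat M A p (x # bs) \<longleftrightarrow> Q x bs" if "x \<in> M" for x
      using p(4)[of M "x # bs" A] that \<open>transitive M\<close> \<open>bs \<in> lists M\<close> \<open>length bs = m\<close> by auto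
    ultimately show ?thesis using j that by auto
  qed
  then show ?thesis
    unfolding D0_def using p j
    by (intro exI[of _ "Ex (Conj (Mem 0 (Suc j)) p)"]) (auto intro: Delta0.intros)
qed

lemma D0_BAll:
  assumes "isvar m v" and "D0 (Suc m) (\<lambda>e. Q (hd e) (tl e))"
  shows "D0 m (\<lambda>e. \<forall>x\<in>elts (v e). Q x e)"
  using D0_Not[OF D0_BEx[OF assms(1) D0_Not[OF assms(2)]]] by (rule D0_cong) auto

lemmas D0_intros = D0_Mem D0_Eq D0_And D0_Or D0_Imp D0_Not D0_BEx D0_BAll isvar_hd isvar_tl isvar_nth

lemma D0_transitive: "isvar m v \<Longrightarrow> D0 m (\<lambda>e. transitive (elts (v e)))"
  unfolding transitive_def subset_iff Ball_def[symmetric]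
  by (intro D0_intros)

lemma D0_list_in: "isvars m n L \<Longrightarrow> isvar m v \<Longrightarrow> D0 m (\<lambda>e. L e \<in> lists (elts (v e)))"
proof (induction n arbitrary: L)
  case 0
  have "D0 m (\<lambda>e. v e = v e)" by (intro D0_intros 0)
  then show ?case by (rule D0_cong) (use 0 in \<open>auto simp: isvars_def\<close>)
next
  case (Suc n)
  have "isvar m (\<lambda>e. L e ! 0)" "isvars m n (\<lambda>e. tl (L e))"
    using Suc.prems isvars_nth isvars_tail by blast+
  then have "D0 m (\<lambda>e. L e ! 0 \<in> elts (v e) \<and> tl (L e) \<in> lists (elts (v e)))"
    using Suc by (intro D0_intros)
  then show ?case
  proof (rule D0_cong)
    fix e :: "'a hset list" assume "length e = m"
    then have "length (L e) = Suc n" using Suc.prems unfolding isvars_def by blast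
    then show "(L e ! 0 \<in> elts (v e) \<and> tl (L e) \<in> lists (elts (v e))) = (L e \<in> lists (elts (v e)))"
      by (cases "L e") auto
  qed
qed

text \<open>
  Truth in a set \<open>z\<close> is \<open>\<Delta>\<^sub>0\<close> in \<open>z\<close>, whatever the complexity of the formula: all its quantifiers become
  bounded by \<open>z\<close>.
\<close>

lemma D0_relativised_pure:
  "pure p \<Longrightarrow> isvar m z \<Longrightarrow> isvars m n L \<Longrightarrow> arity p \<le> n \<Longrightarrow> D0 m (\<lambda>e. sat (elts (z e)) {} p (L e))"
proof (induction p arbitrary: m n z L)
  case (Ex p)
  have "D0 (Suc m) (\<lambda>e. sat (elts (z (tl e))) {} p (hd e # L (tl e)))"
    using Ex.prems
    by (intro Ex.IH[where n = "Suc n"] isvars_Cons isvars_tl) (auto intro: isvar_hd isvar_tl)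
  then show ?case using Ex.prems by (simp add: D0_BEx)
next
  case (Mem i j)
  then show ?case by (auto intro!: D0_Mem isvars_nth)
next
  case (Eq i j)
  then show ?case by (auto intro!: D0_Eq isvars_nth)
next
  case (Neg p)
  then show ?case by (simp add: D0_Not)
next
  case (Conj p q)
  then show ?case by (simp add: D0_And)
qed simp

text \<open>
  The same with the predicate symbol interpreted by the class that \<open>q\<close> defines inside \<open>z\<close>; an
  occurrence of the symbol is replaced by the relativised \<open>q\<close>.
\<close>

lemma D0_relativised:
  "isvar m z \<Longrightarrow> isvars m n L \<Longrightarrow> arity p \<le> n \<Longrightarrow>
   pure q \<Longrightarrow> isvars m k K \<Longrightarrow> arity q \<le> Suc k \<Longrightarrow>
   D0 m (\<lambda>e. sat (elts (z e)) {u. sat (elts (z e)) {} q (u # K e)} p (L e))"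
proof (induction p arbitrary: m n z L K)
  case (Pr i)
  then have "isvar m (\<lambda>e. L e ! i)" unfolding isvars_def by auto
  then have "D0 m (\<lambda>e. sat (elts (z e)) {} q (L e ! i # K e))"
    using Pr by (intro D0_relativised_pure[where n = "Suc k"] isvars_Cons)
  then show ?case by simp
next
  case (Ex p)
  have "D0 (Suc m) (\<lambda>e. sat (elts (z (tl e))) {u. sat (elts (z (tl e))) {} q (u # K (tl e))} p (hd e # L (tl e)))"
    using Ex.prems
    by (intro Ex.IH[where n = "Suc n"] isvars_Cons isvars_tl) (auto intro: isvar_hd isvar_tl)
  then show ?case using Ex.prems by (simp add: D0_BEx)
next
  case (Neg p)
  then show ?case by (simp add: D0_Not)
next
  case (Conj p q)
  then show ?case by (simp add: D0_And)
next
  case (Mem i j)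
  then show ?case by (auto intro!: D0_Mem isvars_nth)
next
  case (Eq i j)
  then show ?case by (auto intro!: D0_Eq isvars_nth)
qed


section \<open>\<open>\<Sigma>\<^sub>2\<close>-nonprojectible ordinals are recursively subtle\<close>

lemma D0E:
  assumes "D0 m P"
  obtains p where "Delta0 p" "pure p" "arity p \<le> m"
    "\<And>M A bs. transitive M \<Longrightarrow> bs \<in> lists M \<Longrightarrow> length bs = m \<Longrightarrow> sat M A p bs \<longleftrightarrow> P bs"
  using assms unfolding D0_def by blast

lemma elementary_Sigma:
  assumes "Sigma_elementary n M N" "Sigma_fm n p" "pure p" "bs \<in> lists M" "arity p \<le> length bs"
  shows "sat M {} p bs \<longleftrightarrow> sat N {} p bs"
  using assms unfolding Sigma_elementary_def elementary_wrt_def by simp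

lemma elementary_Pi:
  assumes "Sigma_elementary n M N" "Pi_fm n p" "pure p" "bs \<in> lists M" "arity p \<le> length bs"
  shows "sat M {} p bs \<longleftrightarrow> sat N {} p bs"
proof -
  obtain q where "Sigma_fm n q" "arity q = arity p" "pure q = pure p"
      "\<And>M A bs. sat (M :: 'a hset set) A q bs \<longleftrightarrow> \<not> sat M A p bs"
    using dual_formula(2)[OF assms(2)] by blast
  with elementary_Sigma[OF assms(1), of q bs] assms(3-5) show ?thesis by simp
qed

text \<open>
  A \<open>\<Sigma>\<^sub>2\<close>-elementary \<open>L\<^sub>\<eta>\<close> is a member of something in \<open>L\<^sub>\<rho>\<close>. Otherwise "some set is a member of no
  set" would be a true \<open>\<Sigma>\<^sub>2\<close> sentence of \<open>L\<^sub>\<rho>\<close>; a witness in \<open>L\<^sub>\<eta>\<close> would still be a witness in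
  \<open>L\<^sub>\<rho>\<close>, but it belongs to \<open>L\<^sub>\<eta>\<close>. So there are levels above \<open>L\<^sub>\<eta>\<close> and below \<open>L\<^sub>\<rho>\<close>, and they contain \<open>b\<close>.
\<close>

lemma nonprojectible_exhausted:
  assumes "Ord \<rho>" "Sigma2_nonprojectible \<rho>"
  shows "exhausted \<rho>"
  unfolding exhausted_def
proof
  fix b assume "b \<in> Lset \<rho>"
  then obtain \<beta> where \<beta>: "\<beta> \<in> elts \<rho>" "elts b \<in> DPow (Lset \<beta>)"
    unfolding Lset_iff[of b] by blast
  obtain \<eta> where \<eta>: "\<eta> \<in> elts \<rho>" "elts \<beta> \<subseteq> elts \<eta>" "Sigma_elementary 2 (Lset \<eta>) (Lset \<rho>)"
    using assms(2) \<beta>(1) unfolding Sigma2_nonprojectible_def by blast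
  define r where "r = Forall (Neg (Mem 1 0))"
  have r: "Pi_fm 1 r" "pure r" "arity r = 1"
    unfolding r_def One_nat_def by (intro Sigma_fm_Pi_fm.intros Delta0.intros | simp)+
  have "Sigma_fm 2 r" "Sigma_fm 2 (Ex r)"
    using r(1) Sigma_fm_Pi_fm.intros(3,4) by (simp_all add: numeral_2_eq_2)
  note s = this
  have sat_r: "sat M {} r [z] \<longleftrightarrow> (\<forall>y\<in>M. z \<notin> elts y)" for M and z :: "'a hset"
    unfolding r_def by simp
  have "\<exists>y\<in>Lset \<rho>. mk (Lset \<eta>) \<in> elts y"
  proof (rule ccontr)
    assume "\<not> ?thesis"
    then have "sat (Lset \<rho>) {} (Ex r) []"
      using mk_Lset_in[OF \<eta>(1)] sat_r by auto
    then have "sat (Lset \<eta>) {} (Ex r) []"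
      using elementary_Sigma[OF \<eta>(3) s(2), of "[]"] r by simp
    then obtain z where z: "z \<in> Lset \<eta>" "sat (Lset \<eta>) {} r [z]" by auto
    then have "sat (Lset \<rho>) {} r [z]"
      using elementary_Sigma[OF \<eta>(3) s(1), of "[z]"] r by simp
    then show False
      using sat_r z(1) mk_Lset_in[OF \<eta>(1)] elts_mk_Lset by blast
  qed
  then obtain y where y: "y \<in> Lset \<rho>" "mk (Lset \<eta>) \<in> elts y" by blast
  then obtain \<gamma> where \<gamma>: "\<gamma> \<in> elts \<rho>" "elts y \<in> DPow (Lset \<gamma>)"
    unfolding Lset_iff[of y] by blast
  then have "mk (Lset \<eta>) \<in> Lset \<gamma>" using y DPow_subset by blast
  then have "\<beta> \<in> elts \<gamma>"
    using mk_Lset_inD[OF _ _ Lset_mono[OF \<eta>(2)]] Ord_elt[OF assms(1)] \<gamma>(1) \<beta>(1) by blast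
  then have "b \<in> Lset \<gamma>" unfolding Lset_iff[of b] using \<beta>(2) by blast
  then show "\<exists>\<kappa>\<in>elts \<rho>. b \<in> Lset \<kappa>" using \<gamma>(1) by blast
qed

lemma sat_empty_persistent:
  assumes "Sigma_fm (Suc 0) p" "transitive M" "transitive N" "M \<subseteq> N" "bs \<in> lists M"
    "arity p \<le> length bs" "sat M {} p bs"
  shows "sat N {} p bs"
  using Sigma1_persistent[OF assms(1-6), of "{}"] assms(7) by simp

text \<open>
  Upwards, \<open>\<Sigma>\<^sub>1(A)\<close> statements persist because levels are transitive. Downwards, the truth of such a
  statement is certified by a transitive set that is correct about \<open>A\<close>. The existence of a certificate is
  a \<open>\<Sigma>\<^sub>2\<close> statement without \<open>A\<close>, so a certificate is found in \<open>L\<^sub>\<eta>\<close>.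
\<close>

lemma Sigma2_elementary_stable:
  fixes \<rho> :: "'k hset"
  assumes "Ord \<rho>" "exhausted \<rho>" and np: "Sigma2_nonprojectible \<rho>"
    and q: "Sigma_fm 1 q" "pure q" "arity q \<le> Suc (length as)"
    and A: "A = {x \<in> Lset \<rho>. sat (Lset \<rho>) {} q (x # as)}"
    and \<eta>: "\<eta> \<in> elts \<rho>" "as \<in> lists (Lset \<eta>)" "Sigma_elementary 2 (Lset \<eta>) (Lset \<rho>)"
  shows "stable A \<rho> \<eta>"
proof -
  have q1: "Sigma_fm (Suc 0) q" using q(1) by simp
  have sub: "Lset \<eta> \<subseteq> Lset \<rho>" using \<eta>(1) by (rule Lset_elt_subset)
  have as: "as \<in> lists (Lset \<rho>)" using \<eta>(2) sub lists_mono by blast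
  note persist = Sigma1_persistent[OF _ transitive_Lset transitive_Lset]
  have "sat (Lset \<eta>) (A \<inter> Lset \<eta>) p cs \<longleftrightarrow> sat (Lset \<rho>) (A \<inter> Lset \<rho>) p cs"
    if p: "Sigma_fm 1 p" and cs: "cs \<in> lists (Lset \<eta>)" "arity p \<le> length cs" for p cs
  proof
    show "sat (Lset \<rho>) (A \<inter> Lset \<rho>) p cs" if "sat (Lset \<eta>) (A \<inter> Lset \<eta>) p cs"
      using persist[OF _ sub cs that] p by simp
  next
    assume *: "sat (Lset \<rho>) (A \<inter> Lset \<rho>) p cs"
    have p1: "Sigma_fm (Suc 0) p" using p by simp
    define k where "k = length cs"
    define l where "l = length as"
    \<comment> \<open>The certificate condition on assignments \<open>[t, z] @ cs @ as\<close>.\<close>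
    define P where "P e \<longleftrightarrow>
        transitive (elts (e ! 1)) \<and> take k (drop 2 e) \<in> lists (elts (e ! 1)) \<and>
        take l (drop (2 + k) e) \<in> lists (elts (e ! 1)) \<and>
        sat (elts (e ! 1)) {u. sat (elts (e ! 1)) {} q (u # take l (drop (2 + k) e))} p (take k (drop 2 e)) \<and>
        (transitive (elts (e ! 0)) \<longrightarrow> take l (drop (2 + k) e) \<in> lists (elts (e ! 0)) \<longrightarrow>
          (\<forall>u\<in>elts (e ! 1). u \<in> elts (e ! 0) \<longrightarrow>
            sat (elts (e ! 0)) {} q (u # take l (drop (2 + k) e)) \<longrightarrow>
            sat (elts (e ! 1)) {} q (u # take l (drop (2 + k) e))))" for e :: "'k hset list"
    have vars: "isvar (2 + k + l) (\<lambda>e. e ! 0)" "isvar (2 + k + l) (\<lambda>e. e ! 1)"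
        "isvars (2 + k + l) k (\<lambda>e. take k (drop 2 e))"
        "isvars (2 + k + l) l (\<lambda>e. take l (drop (2 + k) e))"
      by (auto intro: isvar_nth isvars_segment)
    have "D0 (2 + k + l) P"
      unfolding P_def
      by (intro D0_And D0_Imp D0_BAll D0_Mem D0_transitive D0_list_in vars
          D0_relativised[where n = k and k = l] D0_relativised_pure[where n = "Suc l"]
          isvars_Cons isvars_tl isvar_hd isvar_tl)
        (use q cs vars in \<open>auto simp: k_def l_def\<close>)
    then obtain d where d: "Delta0 d" "pure d" "arity d \<le> 2 + k + l"
      "\<And>M A bs. transitive M \<Longrightarrow> bs \<in> lists M \<Longrightarrow> length bs = 2 + k + l \<Longrightarrow> sat M A d bs \<longleftrightarrow> P bs"
      by (rule D0E) blast
    \<comment> \<open>The certificate condition: \<open>z\<close> satisfies the statement with its own version of \<open>A\<close>, and agrees about \<open>q\<close> with any transitive \<open>t\<close>. Quantified over all \<open>t\<close> this is \<open>\<Pi>\<^sub>1\<close>.\<close>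
    define Q where "Q z t \<longleftrightarrow>
        transitive (elts z) \<and> cs \<in> lists (elts z) \<and> as \<in> lists (elts z) \<and>
        sat (elts z) {u. sat (elts z) {} q (u # as)} p cs \<and>
        (transitive (elts t) \<longrightarrow> as \<in> lists (elts t) \<longrightarrow>
          (\<forall>u\<in>elts z. u \<in> elts t \<longrightarrow> sat (elts t) {} q (u # as) \<longrightarrow> sat (elts z) {} q (u # as)))" for z t
    have PQ: "P (t # z # cs @ as) \<longleftrightarrow> Q z t" for z t
      unfolding P_def Q_def by (simp add: k_def l_def)
    have sat_d: "sat M {} (Forall d) (z # cs @ as) \<longleftrightarrow> (\<forall>t\<in>M. Q z t)"
      if "transitive M" "z \<in> M" "cs \<in> lists M" "as \<in> lists M" for M z
      using that d(4)[OF that(1), of "_ # z # cs @ as" "{}"] by (simp add: PQ k_def l_def)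
    have Pi: "Pi_fm 1 (Forall d)"
      unfolding One_nat_def by (intro Sigma_fm_Pi_fm.intros d)
    then have Sigma: "Sigma_fm 2 (Forall d)" "Sigma_fm 2 (Ex (Forall d))"
      using Sigma_fm_Pi_fm.intros(3,4) by (simp_all add: numeral_2_eq_2)
    obtain \<kappa> where \<kappa>: "\<kappa> \<in> elts \<rho>" "Lset \<eta> \<subseteq> Lset \<kappa>" "sat (Lset \<kappa>) (A \<inter> Lset \<kappa>) p cs"
      using Sigma1_reflects[OF p1 assms(1,2) \<eta>(1) _ cs(2) *] cs sub lists_mono by blast
    obtain \<mu> where \<mu>: "\<mu> \<in> elts \<rho>" "elts \<kappa> \<subseteq> elts \<mu>" "Sigma_elementary 2 (Lset \<mu>) (Lset \<rho>)"
      using np \<kappa>(1) unfolding Sigma2_nonprojectible_def by blast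
    have \<mu>sub: "Lset \<kappa> \<subseteq> Lset \<mu>" "Lset \<eta> \<subseteq> Lset \<mu>" "Lset \<mu> \<subseteq> Lset \<rho>"
      using Lset_mono[OF \<mu>(2)] \<kappa>(2) Lset_elt_subset[OF \<mu>(1)] by auto
    have in\<mu>: "cs \<in> lists (Lset \<mu>)" "as \<in> lists (Lset \<mu>)" "cs \<in> lists (Lset \<kappa>)"
      using cs(1) \<eta>(2) \<mu>sub(2) \<kappa>(2) lists_mono by blast+
    have A\<mu>: "u \<in> A \<longleftrightarrow> sat (Lset \<mu>) {} q (u # as)" if "u \<in> Lset \<mu>" for u
    proof -
      have "sat (Lset \<mu>) {} q (u # as) \<longleftrightarrow> sat (Lset \<rho>) {} q (u # as)"
        by (rule elementary_Sigma[OF \<mu>(3) Sigma_fm_1_2[OF q1] q(2)]) (use that in\<mu> q(3) in auto)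
      then show ?thesis using that \<mu>sub(3) unfolding A by blast
    qed
    \<comment> \<open>A \<open>\<Sigma>\<^sub>2\<close>-elementary level \<open>L\<^sub>\<mu>\<close> above the witnesses is a certificate in \<open>L\<^sub>\<rho>\<close>.\<close>
    have "Q (mk (Lset \<mu>)) t" if "t \<in> Lset \<rho>" for t
    proof -
      have "sat (Lset \<mu>) (A \<inter> Lset \<mu>) p cs"
        using persist[OF p1 \<mu>sub(1) in\<mu>(3) cs(2) \<kappa>(3)] .
      moreover have "sat (Lset \<mu>) {u. sat (Lset \<mu>) {} q (u # as)} p cs \<longleftrightarrow> sat (Lset \<mu>) (A \<inter> Lset \<mu>) p cs"
        by (rule sat_cong_predicate[OF _ in\<mu>(1) cs(2)]) (auto simp: A\<mu>)
      moreover have "sat (Lset \<mu>) {} q (u # as)"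
        if u: "u \<in> Lset \<mu>" "u \<in> elts t" "transitive (elts t)" "as \<in> lists (elts t)"
          "sat (elts t) {} q (u # as)" for u
      proof -
        have "elts t \<subseteq> Lset \<rho>" using \<open>t \<in> Lset \<rho>\<close> transitive_Lset unfolding transitive_def by blast
        then have "sat (Lset \<rho>) {} q (u # as)"
          by (intro sat_empty_persistent[OF q1 u(3) transitive_Lset _ _ _ u(5)]) (use u q in auto)
        then show ?thesis using A\<mu>[OF u(1)] u(1) \<mu>sub(3) unfolding A by blast
      qed
      ultimately show ?thesis
        unfolding Q_def elts_mk_Lset using in\<mu> transitive_Lset by blast
    qed
    then have "sat (Lset \<rho>) {} (Forall d) (mk (Lset \<mu>) # cs @ as)"
      using cs(1) as sub lists_mono[OF sub] mk_Lset_in[OF \<mu>(1)]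
      by (subst sat_d) (auto intro: transitive_Lset)
    then have "sat (Lset \<rho>) {} (Ex (Forall d)) (cs @ as)"
      using mk_Lset_in[OF \<mu>(1)] by auto
    moreover have "sat (Lset \<eta>) {} (Ex (Forall d)) (cs @ as) \<longleftrightarrow> sat (Lset \<rho>) {} (Ex (Forall d)) (cs @ as)"
      by (rule elementary_Sigma[OF \<eta>(3) Sigma(2)]) (use d cs \<eta>(2) in \<open>auto simp: k_def l_def\<close>)
    ultimately obtain z where z: "z \<in> Lset \<eta>" "sat (Lset \<eta>) {} (Forall d) (z # cs @ as)" by auto
    moreover have "sat (Lset \<eta>) {} (Forall d) (z # cs @ as) \<longleftrightarrow> sat (Lset \<rho>) {} (Forall d) (z # cs @ as)"
      by (rule elementary_Sigma[OF \<eta>(3) Sigma(1)]) (use d z cs \<eta>(2) in \<open>auto simp: k_def l_def\<close>)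
    moreover have "z \<in> Lset \<rho>" "cs \<in> lists (Lset \<rho>)" using z(1) cs(1) sub lists_mono by blast+
    ultimately have Q: "Q z t" if "t \<in> Lset \<rho>" for t
      using sat_d[OF transitive_Lset _ _ as] that by blast
    have z_tr: "transitive (elts z)" "cs \<in> lists (elts z)" "as \<in> lists (elts z)"
        "sat (elts z) {u. sat (elts z) {} q (u # as)} p cs"
      using Q[OF \<open>z \<in> Lset \<rho>\<close>] unfolding Q_def by blast+
    have z_sub: "elts z \<subseteq> Lset \<eta>" using z(1) transitive_Lset unfolding transitive_def by blast
    \<comment> \<open>Since \<open>L\<^sub>\<rho>\<close> is a union of transitive sets in \<open>L\<^sub>\<rho>\<close>, comparison with them makes \<open>z\<close> correct about \<open>A\<close>.\<close>
    have A_z: "u \<in> A \<longleftrightarrow> sat (elts z) {} q (u # as)" if u: "u \<in> elts z" for u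
    proof
      assume "u \<in> A"
      then have "sat (Lset \<rho>) ({} \<inter> Lset \<rho>) q (u # as)" unfolding A by simp
      then obtain \<tau> where \<tau>: "\<tau> \<in> elts \<rho>" "u # as \<in> lists (Lset \<tau>)"
          "sat (Lset \<tau>) ({} \<inter> Lset \<tau>) q (u # as)"
        using Sigma1_reflects[OF q1 assms(1,2) \<eta>(1), of "u # as" "{}"] u z_sub sub as q(3) by auto
      then show "sat (elts z) {} q (u # as)"
        using Q[OF mk_Lset_in[OF \<tau>(1)]] u unfolding Q_def elts_mk_Lset
        by (simp add: transitive_Lset)
    next
      assume "sat (elts z) {} q (u # as)"
      then have "sat (Lset \<rho>) {} q (u # as)"
        by (rule sat_empty_persistent[OF q1 z_tr(1) transitive_Lset, rotated 3]) (use u z_sub z_tr sub q in auto)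
      then show "u \<in> A" using u z_sub sub unfolding A by blast
    qed
    have "sat (elts z) (A \<inter> elts z) p cs \<longleftrightarrow> sat (elts z) {u. sat (elts z) {} q (u # as)} p cs"
      by (rule sat_cong_predicate[OF _ z_tr(2) cs(2)]) (auto simp: A_z)
    then show "sat (Lset \<eta>) (A \<inter> Lset \<eta>) p cs"
      using z_tr by (intro Sigma1_persistent[OF p1 z_tr(1) transitive_Lset z_sub z_tr(2) cs(2)]) simp
  qed
  then show ?thesis unfolding stable_def elementary_wrt_def using sub by simp
qed

lemma nonprojectible_subtle:
  assumes "Ord \<rho>" "Sigma2_nonprojectible \<rho>"
  shows "recursively_subtle \<rho>"
  unfolding recursively_subtle_def Pi2_reflecting_onto_def
proof (intro allI impI, elim conjE)
  fix A p bs
  assume "rec_enumerable \<rho> A"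
  then obtain q as where q: "Sigma_fm 1 q" "pure q" "arity q \<le> Suc (length as)"
    and as: "as \<in> lists (Lset \<rho>)" and A: "A = {x \<in> Lset \<rho>. sat (Lset \<rho>) {} q (x # as)}"
    unfolding rec_enumerable_def by blast
  assume p: "Pi_fm 2 p" "pure p" "arity p \<le> length bs" "sat (Lset \<rho>) {} p bs"
    and bs: "bs \<noteq> []" "bs \<in> lists (Lset \<rho>)"
  note ex = nonprojectible_exhausted[OF assms]
  obtain \<beta> where "\<beta> \<in> elts \<rho>" using bs unfolding neq_Nil_conv by (auto simp: Lset_iff[of _ \<rho>])
  then obtain \<kappa> where \<kappa>: "\<kappa> \<in> elts \<rho>" "bs @ as \<in> lists (Lset \<kappa>)"
    using exhausted_list[OF assms(1) ex, of \<beta> "bs @ as"] bs as by auto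
  obtain \<eta> where \<eta>: "\<eta> \<in> elts \<rho>" "elts \<kappa> \<subseteq> elts \<eta>" "Sigma_elementary 2 (Lset \<eta>) (Lset \<rho>)"
    using assms(2) \<kappa>(1) unfolding Sigma2_nonprojectible_def by blast
  have in\<eta>: "bs \<in> lists (Lset \<eta>)" "as \<in> lists (Lset \<eta>)"
    using \<kappa>(2) Lset_mono[OF \<eta>(2)] by auto
  have "stable A \<rho> \<eta>"
    by (rule Sigma2_elementary_stable[OF assms(1) ex assms(2) q A \<eta>(1) in\<eta>(2) \<eta>(3)])
  moreover have "sat (Lset \<eta>) {} p bs"
    using elementary_Pi[OF \<eta>(3) p(1,2) in\<eta>(1) p(3)] p(4) by blast
  ultimately show "\<exists>\<alpha>\<in>elts \<rho>. \<alpha> \<in> {\<kappa> \<in> elts \<rho>. stable A \<rho> \<kappa>} \<and> bs \<in> lists (Lset \<alpha>) \<and> sat (Lset \<alpha>) {} p bs"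
    using \<eta>(1) in\<eta> by blast
qed


section \<open>Codes of formulas and assignments\<close>

definition adjoin :: "'k hset \<Rightarrow> 'k hset \<Rightarrow> 'k hset" where
  "adjoin x y = mk (insert x (elts y))"

lemma elts_adjoin [simp]: "elts (adjoin x y) = insert x (elts y)"
proof -
  have "small TYPE('a) (\<Union>D\<in>{{x}, elts y}. D)"
    by (rule small_UN) (auto simp: small_countable small_iff_elts[of "elts y"])
  then show ?thesis unfolding adjoin_def by (intro elts_mk) simp
qed

definition hempty :: "'k hset" where
  "hempty = mk {}"

lemma elts_hempty [simp]: "elts hempty = {}"
  unfolding hempty_def by (simp add: elts_mk_finite)

lemma adjoin_iff: "u = adjoin x y \<longleftrightarrow> elts u = insert x (elts y)"
  by (metis elts_inject elts_adjoin)

lemma hempty_iff: "u = hempty \<longleftrightarrow> elts u = {}"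
  by (metis elts_inject elts_hempty)

definition upair :: "'k hset \<Rightarrow> 'k hset \<Rightarrow> 'k hset" where
  "upair x y = adjoin x (adjoin y hempty)"

definition pair :: "'k hset \<Rightarrow> 'k hset \<Rightarrow> 'k hset" where
  "pair x y = upair (upair x x) (upair x y)"

lemma elts_upair [simp]: "elts (upair x y) = {x, y}"
  unfolding upair_def by simp

lemma upair_iff: "u = upair x y \<longleftrightarrow> elts u = {x, y}"
  by (metis elts_inject elts_upair)

lemma pair_inject [simp]: "pair x y = pair x' y' \<longleftrightarrow> x = x' \<and> y = y'"
  unfolding pair_def upair_iff by (auto simp: doubleton_eq_iff elts_inject[symmetric])

text \<open>
  Zermelo numerals, serving as tags and as names of variables.
\<close>

primrec hnum :: "nat \<Rightarrow> 'k hset" where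
  "hnum 0 = hempty"
| "hnum (Suc n) = adjoin (hnum n) hempty"

declare hnum.simps [simp del]

lemma hnum_inject [simp]: "(hnum m :: 'k hset) = hnum n \<longleftrightarrow> m = n"
proof (induction m arbitrary: n)
  case 0
  then show ?case by (cases n) (auto simp: hnum.simps elts_inject[symmetric])
next
  case (Suc m)
  then show ?case by (cases n) (auto simp: hnum.simps elts_inject[symmetric])
qed

text \<open>
  An assignment as a finite function. A variable is named by its de Bruijn level, the distance from the
  end of the list, which does not change when a quantifier puts a new value in front; extending an
  assignment thus only adds one pair.
\<close>

fun env :: "'k hset list \<Rightarrow> 'k hset" where
  "env [] = hempty"
| "env (x # xs) = adjoin (pair (hnum (length xs)) x) (env xs)"

lemma pair_in_env_iff:
  "pair (hnum l) v \<in> elts (env xs) \<longleftrightarrow> l < length xs \<and> v = xs ! (length xs - Suc l)"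
  by (induction xs) (auto simp: less_Suc_eq nth_Cons' Suc_diff_Suc)

lemma lookup_env: "i < length xs \<Longrightarrow> pair (hnum (length xs - Suc i)) v \<in> elts (env xs) \<longleftrightarrow> v = xs ! i"
  by (auto simp: pair_in_env_iff Suc_diff_Suc)

definition node :: "nat \<Rightarrow> 'k hset \<Rightarrow> 'k hset \<Rightarrow> 'k hset" where
  "node k x y = pair (hnum k) (pair x y)"

text \<open>
  The code of the negation normal form of \<open>p\<close>, or of \<open>\<not> p\<close> if \<open>b\<close> is false, for assignments of length
  \<open>n\<close>. Negations are absorbed into the tag: even tags stand for membership, equality, conjunction and
  existential quantification, each followed by the tag of its dual. Only pure formulas are coded
  faithfully.
\<close>

primrec code :: "fm \<Rightarrow> bool \<Rightarrow> nat \<Rightarrow> 'k hset" where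
  "code (Mem i j) b n = node (if b then 0 else 1) (hnum (n - Suc i)) (hnum (n - Suc j))"
| "code (Eq i j) b n = node (if b then 2 else 3) (hnum (n - Suc i)) (hnum (n - Suc j))"
| "code (Pr i) b n = hempty"
| "code (Neg p) b n = code p (\<not> b) n"
| "code (Conj p q) b n = node (if b then 4 else 5) (code p b n) (code q b n)"
| "code (Ex p) b n = node (if b then 6 else 7) (hnum n) (code p b (Suc n))"

text \<open>
  Closure under \<open>adjoin\<close> suffices to contain all codes, and all assignments and positions built from
  members.
\<close>

definition closed :: "'k hset set \<Rightarrow> bool" where
  "closed M \<longleftrightarrow> hempty \<in> M \<and> (\<forall>x\<in>M. \<forall>y\<in>M. adjoin x y \<in> M)"

lemma closed_hempty: "closed M \<Longrightarrow> hempty \<in> M"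
  and closed_adjoin: "closed M \<Longrightarrow> x \<in> M \<Longrightarrow> y \<in> M \<Longrightarrow> adjoin x y \<in> M"
  unfolding closed_def by auto

lemma closed_pair: "closed M \<Longrightarrow> x \<in> M \<Longrightarrow> y \<in> M \<Longrightarrow> pair x y \<in> M"
  unfolding pair_def upair_def by (intro closed_adjoin closed_hempty)

lemma closed_hnum: "closed M \<Longrightarrow> hnum n \<in> M"
  by (induction n) (auto simp: hnum.simps intro: closed_adjoin closed_hempty)

lemma closed_env: "closed M \<Longrightarrow> xs \<in> lists M \<Longrightarrow> env xs \<in> M"
  by (induction xs) (auto intro: closed_adjoin closed_hempty closed_pair closed_hnum)

lemma closed_code: "closed M \<Longrightarrow> code p b n \<in> M"
  by (induction p arbitrary: b n)
     (simp_all add: node_def closed_hempty closed_pair closed_hnum)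

section \<open>\<open>\<Delta>\<^sub>0\<close>-definability of pairs, codes and assignments\<close>

lemma D0_upair:
  assumes "isvar m u" "isvar m x" "isvar m y"
  shows "D0 m (\<lambda>e. u e = upair (x e) (y e))"
proof -
  have "D0 m (\<lambda>e. x e \<in> elts (u e) \<and> y e \<in> elts (u e) \<and> (\<forall>r\<in>elts (u e). r = x e \<or> r = y e))"
    by (intro D0_intros assms)
  then show ?thesis by (rule D0_cong) (auto simp: upair_iff)
qed

lemma D0_pair:
  assumes "isvar m u" "isvar m x" "isvar m y"
  shows "D0 m (\<lambda>e. u e = pair (x e) (y e))"
proof -
  have "D0 m (\<lambda>e. \<exists>p\<in>elts (u e). \<exists>q\<in>elts (u e). p = upair (x e) (x e) \<and> q = upair (x e) (y e) \<and> u e = upair p q)"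
    by (rule assms | rule D0_upair | rule D0_intros)+
  then show ?thesis by (rule D0_cong) (auto simp: pair_def)
qed

text \<open>
  The components of a pair are members of its members, so the quantifiers are bounded.
\<close>

lemma D0_ex_pair:
  assumes "isvar m u" "D0 (Suc (Suc (Suc m))) (\<lambda>e. Q (hd (tl e)) (hd e) (tl (tl (tl e))))"
  shows "D0 m (\<lambda>e. \<exists>x y. u e = pair x y \<and> Q x y e)"
proof -
  have "D0 m (\<lambda>e. \<exists>p\<in>elts (u e). \<exists>x\<in>elts p. \<exists>y\<in>elts p. u e = pair x y \<and> Q x y e)"
    by (rule assms | rule D0_pair | rule D0_intros)+
  then show ?thesis by (rule D0_cong) (auto simp: pair_def)
qed

lemma D0_pair_in:
  assumes "isvar m u" "isvar m x" "isvar m y"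
  shows "D0 m (\<lambda>e. pair (x e) (y e) \<in> elts (u e))"
proof -
  have "D0 m (\<lambda>e. \<exists>r\<in>elts (u e). r = pair (x e) (y e))"
    by (rule assms | rule D0_pair | rule D0_intros)+
  then show ?thesis by (rule D0_cong) auto
qed

lemma D0_hempty: "isvar m u \<Longrightarrow> D0 m (\<lambda>e. u e = hempty)"
proof -
  assume "isvar m u"
  then have "D0 m (\<lambda>e. \<forall>r\<in>elts (u e). \<not> r = r)" by (intro D0_intros)
  then show ?thesis by (rule D0_cong) (auto simp: hempty_iff adjoin_iff)
qed

lemma D0_adjoin:
  assumes "isvar m u" "isvar m x" "isvar m y"
  shows "D0 m (\<lambda>e. u e = adjoin (x e) (y e))"
proof -
  have "D0 m (\<lambda>e. x e \<in> elts (u e) \<and> (\<forall>r\<in>elts (y e). r \<in> elts (u e)) \<and>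
      (\<forall>r\<in>elts (u e). r = x e \<or> r \<in> elts (y e)))"
    by (intro D0_intros assms)
  then show ?thesis by (rule D0_cong) (auto simp: hempty_iff adjoin_iff)
qed

lemma D0_hnum: "isvar m u \<Longrightarrow> D0 m (\<lambda>e. u e = hnum k)"
proof (induction k arbitrary: m u)
  case 0
  then show ?case by (simp add: hnum.simps D0_hempty)
next
  case (Suc k)
  have "D0 m (\<lambda>e. \<exists>r\<in>elts (u e). r = hnum k \<and> (\<forall>r'\<in>elts (u e). r' = r))"
    by (rule Suc | rule D0_intros)+
  then show ?case by (rule D0_cong) (auto simp: hnum.simps adjoin_iff)
qed

lemma D0_pair_hnum:
  assumes "isvar m u" "isvar m x"
  shows "D0 m (\<lambda>e. u e = pair (hnum k) (x e))"
proof -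
  have "D0 m (\<lambda>e. \<exists>y z. u e = pair y z \<and> (y = hnum k \<and> z = x e))"
    by (rule assms | rule D0_ex_pair D0_hnum | rule D0_intros)+
  then show ?thesis by (rule D0_cong) auto
qed

lemma isvars_0: "isvars m 0 L \<Longrightarrow> length e = m \<Longrightarrow> L e = []"
  using isvars_length by fastforce

lemma D0_in_env: "isvars m n L \<Longrightarrow> isvar m u \<Longrightarrow> D0 m (\<lambda>e. u e \<in> elts (env (L e)))"
proof (induction n arbitrary: L)
  case 0
  have "D0 m (\<lambda>e. \<not> u e = u e)" by (intro D0_intros 0)
  then show ?case by (rule D0_cong) (simp add: isvars_0[OF 0(1)])
next
  case (Suc n)
  have "D0 m (\<lambda>e. u e = pair (hnum n) (L e ! 0) \<or> u e \<in> elts (env (tl (L e))))"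
    by (intro D0_Or D0_pair_hnum isvars_nth[OF Suc.prems(1)] Suc.IH isvars_tail Suc.prems) simp
  then show ?case
  proof (rule D0_cong)
    fix e :: "'a hset list" assume "length e = m"
    then obtain x xs where "L e = x # xs" "length xs = n"
      using isvars_length[OF Suc.prems(1)] by (metis length_Suc_conv)
    then show "(u e = pair (hnum n) (L e ! 0) \<or> u e \<in> elts (env (tl (L e)))) = (u e \<in> elts (env (L e)))" by simp
  qed
qed

lemma D0_env_subset: "isvars m n L \<Longrightarrow> isvar m u \<Longrightarrow> D0 m (\<lambda>e. elts (env (L e)) \<subseteq> elts (u e))"
proof (induction n arbitrary: L)
  case 0
  have "D0 m (\<lambda>e. u e = u e)" by (intro D0_intros 0)
  then show ?case by (rule D0_cong) (simp add: isvars_0[OF 0(1)])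
next
  case (Suc n)
  have "D0 m (\<lambda>e. (\<exists>r\<in>elts (u e). r = pair (hnum n) (L e ! 0)) \<and> elts (env (tl (L e))) \<subseteq> elts (u e))"
    by (intro D0_And D0_BEx D0_pair_hnum isvar_hd isvar_tl isvars_nth[OF Suc.prems(1)] Suc.IH isvars_tail Suc.prems) 
      (simp_all add: isvar_tl[OF isvars_nth[OF Suc.prems(1)]])
  then show ?case
  proof (rule D0_cong)
    fix e :: "'a hset list" assume "length e = m"
    then obtain x xs where "L e = x # xs" "length xs = n"
      using isvars_length[OF Suc.prems(1)] by (metis length_Suc_conv)
    then show "((\<exists>r\<in>elts (u e). r = pair (hnum n) (L e ! 0)) \<and> elts (env (tl (L e))) \<subseteq> elts (u e)) = (elts (env (L e)) \<subseteq> elts (u e))" by simp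
  qed
qed

lemma D0_pair_env:
  assumes "isvars m n L" "isvar m u" "isvar m c"
  shows "D0 m (\<lambda>e. u e = pair (c e) (env (L e)))"
proof -
  have "D0 m (\<lambda>e. \<exists>x y. u e = pair x y \<and> (x = c e \<and>
      ((\<forall>r\<in>elts y. r \<in> elts (env (L e))) \<and> elts (env (L e)) \<subseteq> elts y)))"
    by (rule assms isvars_tl | rule D0_ex_pair D0_in_env[where n = n] D0_env_subset[where n = n] | rule D0_intros)+
  moreover have "(\<forall>r\<in>elts y. r \<in> elts v) \<and> elts v \<subseteq> elts y \<longleftrightarrow> y = v" for y v :: "'a hset"
    using elts_inject[of y v] by auto
  ultimately show ?thesis by simp
qed

text \<open>
  Quantification over tuples of fixed length is iterated bounded quantification; the innermost
  quantifier supplies the head of the list, hence \<open>xs @ [x]\<close> in the induction step.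
\<close>

lemma D0_BEx_list:
  assumes "isvar m z" "D0 (n + m) (\<lambda>e. Q (take n e) (drop n e))"
  shows "D0 m (\<lambda>e. \<exists>xs\<in>lists (elts (z e)). length xs = n \<and> Q xs e)"
  using assms
proof (induction n arbitrary: m z Q)
  case 0
  then show ?case by simp
next
  case (Suc n)
  have "D0 (n + Suc m) (\<lambda>e. Q (take n e @ [hd (drop n e)]) (tl (drop n e)))"
    using D0_cong[OF Suc.prems(2), of "\<lambda>e. Q (take n e @ [hd (drop n e)]) (tl (drop n e))"]
    by (simp add: take_Suc_conv_app_nth hd_drop_conv_nth drop_Suc tl_drop)
  then have "D0 (Suc m) (\<lambda>e. \<exists>xs\<in>lists (elts (z (tl e))). length xs = n \<and> Q (xs @ [hd e]) (tl e))"
    by (intro Suc.IH isvar_tl Suc.prems(1))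
  then have "D0 m (\<lambda>e. \<exists>x\<in>elts (z e). \<exists>xs\<in>lists (elts (z e)). length xs = n \<and> Q (xs @ [x]) e)"
    by (intro D0_BEx Suc.prems(1))
  then show ?case
  proof (rule D0_cong)
    fix e :: "'a hset list"
    show "(\<exists>x\<in>elts (z e). \<exists>xs\<in>lists (elts (z e)). length xs = n \<and> Q (xs @ [x]) e) =
      (\<exists>xs\<in>lists (elts (z e)). length xs = Suc n \<and> Q xs e)" (is "?l = ?r")
    proof
      assume ?l
      then obtain x xs where "x \<in> elts (z e)" "xs \<in> lists (elts (z e))" "length xs = n" "Q (xs @ [x]) e"
        by blast
      then show ?r by (intro bexI[of _ "xs @ [x]"]) auto
    next
      assume ?r
      then obtain xs x where "xs @ [x] \<in> lists (elts (z e))" "length xs = n" "Q (xs @ [x]) e"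
        by (metis length_Suc_conv_rev)
      then show ?l by (intro bexI[of _ x] bexI[of _ xs]) auto
    qed
  qed
qed

section \<open>Hintikka sets and the universal \<open>\<Sigma>\<^sub>1\<close> class\<close>

text \<open>
  The move \<open>k x y\<close> at an assignment \<open>e\<close> is justified if the literal it denotes is true, or if \<open>s\<close>
  contains the positions that its connective asks for: both conjuncts, one disjunct, one instance or
  all instances.
\<close>

definition move_justified :: "'k hset \<Rightarrow> 'k hset \<Rightarrow> 'k hset \<Rightarrow> 'k hset \<Rightarrow> 'k hset \<Rightarrow> 'k hset \<Rightarrow> bool" where
  "move_justified z s k x y e \<longleftrightarrow>
     (k = hnum 0 \<and> (\<exists>u\<in>elts z. \<exists>v\<in>elts z. pair x u \<in> elts e \<and> pair y v \<in> elts e \<and> u \<in> elts v)) \<or>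
     (k = hnum 1 \<and> (\<exists>u\<in>elts z. \<exists>v\<in>elts z. pair x u \<in> elts e \<and> pair y v \<in> elts e \<and> u \<notin> elts v)) \<or>
     (k = hnum 2 \<and> (\<exists>u\<in>elts z. \<exists>v\<in>elts z. pair x u \<in> elts e \<and> pair y v \<in> elts e \<and> u = v)) \<or>
     (k = hnum 3 \<and> (\<exists>u\<in>elts z. \<exists>v\<in>elts z. pair x u \<in> elts e \<and> pair y v \<in> elts e \<and> u \<noteq> v)) \<or>
     (k = hnum 4 \<and> pair x e \<in> elts s \<and> pair y e \<in> elts s) \<or>
     (k = hnum 5 \<and> (pair x e \<in> elts s \<or> pair y e \<in> elts s)) \<or>
     (k = hnum 6 \<and> (\<exists>u\<in>elts z. pair y (adjoin (pair x u) e) \<in> elts s)) \<or>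
     (k = hnum 7 \<and> (\<forall>u\<in>elts z. pair y (adjoin (pair x u) e) \<in> elts s))"

definition justified :: "'k hset \<Rightarrow> 'k hset \<Rightarrow> 'k hset \<Rightarrow> bool" where
  "justified z s w \<longleftrightarrow> (\<exists>c e. w = pair c e \<and> (\<exists>k d. c = pair k d \<and> (\<exists>x y. d = pair x y \<and> move_justified z s k x y e)))"

definition hintikka :: "'k hset \<Rightarrow> 'k hset \<Rightarrow> bool" where
  "hintikka z s \<longleftrightarrow> (\<forall>w\<in>elts s. justified z s w)"

lemma D0_extended_position:
  assumes "isvar m s" "isvar m y" "isvar m x" "isvar m u" "isvar m e'"
  shows "D0 m (\<lambda>e. pair (y e) (adjoin (pair (x e) (u e)) (e' e)) \<in> elts (s e))"
proof -
  have "D0 m (\<lambda>e. \<exists>w\<in>elts (s e). \<exists>a f. w = pair a f \<and> (a = y e \<and>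
      (\<exists>q\<in>elts f. q = pair (x e) (u e) \<and> f = adjoin q (e' e))))"
    by (rule assms | rule D0_ex_pair D0_pair D0_adjoin | rule D0_intros)+
  then show ?thesis by (rule D0_cong) auto
qed

lemma D0_move_justified:
  assumes "isvar m z" "isvar m s" "isvar m k" "isvar m x" "isvar m y" "isvar m e'"
  shows "D0 m (\<lambda>e. move_justified (z e) (s e) (k e) (x e) (y e) (e' e))"
proof -
  have tag: "D0 m (\<lambda>e. k e = hnum i)" for i
    by (rule D0_hnum[OF assms(3)])
  have atom: "D0 m (\<lambda>e. \<exists>u\<in>elts (z e). \<exists>v\<in>elts (z e).
      pair (x e) u \<in> elts (e' e) \<and> pair (y e) v \<in> elts (e' e) \<and> R u v)"
    if "D0 (Suc (Suc m)) (\<lambda>e. R (hd (tl e)) (hd e))" for R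
    by (intro D0_BEx D0_And D0_pair_in isvar_hd isvar_tl assms that)
  have mem: "D0 (Suc (Suc m)) (\<lambda>e. hd (tl e) \<in> elts (hd e))"
    and eq: "D0 (Suc (Suc m)) (\<lambda>e. hd (tl e) = hd e)"
    by (intro D0_Mem D0_Eq isvar_hd isvar_tl)+
  have ext: "D0 (Suc m) (\<lambda>e. pair (y (tl e)) (adjoin (pair (x (tl e)) (hd e)) (e' (tl e))) \<in> elts (s (tl e)))"
    by (intro D0_extended_position isvar_hd isvar_tl assms)
  have and_or: "D0 m (\<lambda>e. pair (x e) (e' e) \<in> elts (s e) \<and> pair (y e) (e' e) \<in> elts (s e))"
    "D0 m (\<lambda>e. pair (x e) (e' e) \<in> elts (s e) \<or> pair (y e) (e' e) \<in> elts (s e))"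
    by (intro D0_And D0_Or D0_pair_in assms)+
  show ?thesis
    unfolding move_justified_def
    by (intro D0_Or D0_And[OF tag] and_or atom[OF mem] atom[OF D0_Not[OF mem]] atom[OF eq]
        atom[OF D0_Not[OF eq]] D0_BEx[OF assms(1) ext] D0_BAll[OF assms(1) ext])
qed

lemma D0_justified:
  assumes "isvar m z" "isvar m s" "isvar m w"
  shows "D0 m (\<lambda>e. justified (z e) (s e) (w e))"
  unfolding justified_def
  apply (rule D0_ex_pair, rule assms)
  apply (rule D0_ex_pair, (rule isvar_hd isvar_tl)+)
  apply (rule D0_ex_pair, (rule isvar_hd isvar_tl)+)
  apply (rule D0_move_justified)
       apply (rule isvar_tl)+ apply (rule assms)
      apply (rule isvar_tl)+ apply (rule assms)
     apply (rule isvar_hd isvar_tl)+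
  done

lemma D0_hintikka:
  assumes "isvar m z" "isvar m s"
  shows "D0 m (\<lambda>e. hintikka (z e) (s e))"
  unfolding hintikka_def
  by (rule D0_BAll[OF assms(2)]) (rule D0_justified[OF isvar_tl[OF assms(1)] isvar_tl[OF assms(2)] isvar_hd])

lemma justified_node [simp]: "justified z s (pair (node k x y) e) \<longleftrightarrow> move_justified z s (hnum k) x y e"
  unfolding justified_def node_def by auto

lemma move_justified_mono: "elts s \<subseteq> elts t \<Longrightarrow> move_justified z s k x y e \<Longrightarrow> move_justified z t k x y e"
  unfolding move_justified_def by (elim disjE) (simp_all add: subset_iff, (metis | blast)+)

lemma justified_mono: "elts s \<subseteq> elts t \<Longrightarrow> justified z s w \<Longrightarrow> justified z t w"
  unfolding justified_def using move_justified_mono by blast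

text \<open>
  Positions of a Hintikka set are true: each is justified by positions for immediate subformulas.
\<close>

lemma hintikka_sound:
  assumes "hintikka z s"
  shows "pure p \<Longrightarrow> arity p \<le> length xs \<Longrightarrow> xs \<in> lists (elts z) \<Longrightarrow>
    pair (code p b (length xs)) (env xs) \<in> elts s \<Longrightarrow> sat (elts z) {} p xs \<longleftrightarrow> b"
proof (induction p arbitrary: b xs)
  case (Mem i j)
  then have "justified z s (pair (code (Mem i j) b (length xs)) (env xs))"
    using assms unfolding hintikka_def by blast
  then show ?case using Mem by (auto simp: move_justified_def lookup_env split: if_splits)
next
  case (Eq i j)
  then have "justified z s (pair (code (Eq i j) b (length xs)) (env xs))"
    using assms unfolding hintikka_def by blast
  then show ?case using Eq by (auto simp: move_justified_def lookup_env split: if_splits)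
next
  case (Neg p)
  then show ?case using Neg.IH[of xs "\<not> b"] by simp
next
  case (Conj p q)
  then have "justified z s (pair (code (Conj p q) b (length xs)) (env xs))"
    using assms unfolding hintikka_def by blast
  then show ?case using Conj.prems Conj.IH(1)[of xs b] Conj.IH(2)[of xs b]
    by (auto simp: move_justified_def split: if_splits)
next
  case (Ex p)
  then have j: "justified z s (pair (code (Ex p) b (length xs)) (env xs))"
    using assms unfolding hintikka_def by blast
  have "sat (elts z) {} p (x # xs) \<longleftrightarrow> b"
    if "x \<in> elts z" "pair (code p b (Suc (length xs))) (env (x # xs)) \<in> elts s" for x
    using Ex.IH[of "x # xs" b] Ex.prems that by auto
  with j show ?case by (cases b) (auto simp: move_justified_def)
qed simp

text \<open>
  The requirement that \<open>w\<close> belongs to the transitive set \<open>z\<close> puts all values of the assignment into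
  \<open>z\<close>, so that truth of a \<open>\<Sigma>\<^sub>1\<close> formula in \<open>z\<close> persists to \<open>L\<^sub>\<rho>\<close>.
\<close>

definition universal :: "'k hset \<Rightarrow> 'k hset set" where
  "universal \<rho> = {w \<in> Lset \<rho>. \<exists>z\<in>Lset \<rho>. \<exists>s\<in>Lset \<rho>.
     transitive (elts z) \<and> w \<in> elts z \<and> w \<in> elts s \<and> hintikka z s}"

lemma universal_subset: "universal \<rho> \<subseteq> Lset \<rho>"
  unfolding universal_def by blast

lemma rec_enumerable_universal: "rec_enumerable \<rho> (universal \<rho>)"
proof -
  have "D0 3 (\<lambda>e. transitive (elts (e ! 1)) \<and> e ! 2 \<in> elts (e ! 1) \<and> e ! 2 \<in> elts (e ! 0) \<and>
      hintikka (e ! 1) (e ! 0 :: 'a hset))"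
    by (intro D0_intros D0_transitive D0_hintikka) simp_all
  then obtain d where d: "Delta0 d" "pure d" "arity d \<le> 3"
    "\<And>M A bs. transitive M \<Longrightarrow> bs \<in> lists M \<Longrightarrow> length bs = 3 \<Longrightarrow> sat M A d bs \<longleftrightarrow>
       transitive (elts (bs ! 1)) \<and> bs ! 2 \<in> elts (bs ! 1) \<and> bs ! 2 \<in> elts (bs ! 0) \<and>
       hintikka (bs ! 1) (bs ! 0 :: 'a hset)"
    by (rule D0E) blast
  have "Sigma_fm 1 (Ex (Ex d))"
    unfolding One_nat_def by (intro Sigma_fm_Pi_fm.intros d)
  moreover have "sat (Lset \<rho>) {} (Ex (Ex d)) [w] \<longleftrightarrow> (\<exists>z\<in>Lset \<rho>. \<exists>s\<in>Lset \<rho>.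
      transitive (elts z) \<and> w \<in> elts z \<and> w \<in> elts s \<and> hintikka z s)" if "w \<in> Lset \<rho>" for w
    using d(4)[OF transitive_Lset, of "[_, _, w]" \<rho>] that by (simp add: numeral_2_eq_2 cong: bex_cong)
  then have "universal \<rho> = {x \<in> Lset \<rho>. sat (Lset \<rho>) {} (Ex (Ex d)) (x # [])}"
    unfolding universal_def by blast
  ultimately show ?thesis
    unfolding rec_enumerable_def using d(2,3) by (intro exI[of _ "Ex (Ex d)"] exI[of _ "[]"]) simp
qed

section \<open>Closure properties of stable levels\<close>

lemma stable_Sigma1:
  assumes "stable A \<rho> \<kappa>" "Sigma_fm 1 p" "pure p" "bs \<in> lists (Lset \<kappa>)" "arity p \<le> length bs"
  shows "sat (Lset \<kappa>) {} p bs \<longleftrightarrow> sat (Lset \<rho>) {} p bs"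
  using assms sat_pure[OF assms(3)] unfolding stable_def elementary_wrt_def by blast

lemma stable_Pi1:
  assumes "stable A \<rho> \<kappa>" "Pi_fm 1 p" "pure p" "bs \<in> lists (Lset \<kappa>)" "arity p \<le> length bs"
  shows "sat (Lset \<kappa>) {} p bs \<longleftrightarrow> sat (Lset \<rho>) {} p bs"
proof -
  obtain q where "Sigma_fm 1 q" "arity q = arity p" "pure q = pure p"
      "\<And>M A bs. sat (M :: 'a hset set) A q bs \<longleftrightarrow> \<not> sat M A p bs"
    using dual_formula(2)[OF assms(2)] by blast
  with stable_Sigma1[OF assms(1), of q bs] assms(3-5) show ?thesis by simp
qed

text \<open>
  A subset of \<open>L\<^sub>\<kappa>\<close> that is \<open>\<Delta>\<^sub>0\<close> with parameters from \<open>L\<^sub>\<kappa>\<close> is definable over \<open>L\<^sub>\<kappa>\<close>, hence constructed at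
  the next level.
\<close>

lemma Lset_separation:
  assumes "D0 (Suc m) P" "\<kappa> \<in> elts \<rho>" "bs \<in> lists (Lset \<kappa>)" "length bs = m"
  shows "\<exists>s\<in>Lset \<rho>. elts s = {x \<in> Lset \<kappa>. P (x # bs)}"
proof -
  obtain d where d: "Delta0 d" "pure d" "arity d \<le> Suc m"
    "\<And>M A bs. transitive M \<Longrightarrow> bs \<in> lists M \<Longrightarrow> length bs = Suc m \<Longrightarrow> sat M A d bs \<longleftrightarrow> P bs"
    using assms(1) by (rule D0E) blast
  have "{x \<in> Lset \<kappa>. P (x # bs)} = {x \<in> Lset \<kappa>. sat (Lset \<kappa>) {} d (x # bs)}"
    using d(4)[OF transitive_Lset, of "_ # bs" \<kappa>] assms(3,4) by auto
  then have D: "{x \<in> Lset \<kappa>. P (x # bs)} \<in> DPow (Lset \<kappa>)"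
    unfolding DPow_def using d(2,3) assms(3,4) by blast
  then obtain s where "elts s = {x \<in> Lset \<kappa>. P (x # bs)}"
    using DPow_Lset_represented by blast
  then show ?thesis using D assms(2) Lset_iff[of s \<rho>] by auto
qed

lemma exhausted_closed:
  assumes "Ord \<rho>" "exhausted \<rho>" "\<beta> \<in> elts \<rho>"
  shows "closed (Lset \<rho>)"
  unfolding closed_def
proof (intro conjI ballI)
  have "D0 (Suc 0) (\<lambda>e :: 'a hset list. \<not> e ! 0 = e ! 0)" by (intro D0_intros) simp_all
  from Lset_separation[OF this assms(3), of "[]"]
  obtain s where "s \<in> Lset \<rho>" "elts s = {}" by auto
  then show "hempty \<in> Lset \<rho>" by (metis elts_hempty elts_inject)
next
  fix x y assume xy: "x \<in> Lset \<rho>" "y \<in> Lset \<rho>"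
  obtain \<kappa> where \<kappa>: "\<kappa> \<in> elts \<rho>" "[x, y] \<in> lists (Lset \<kappa>)"
    using exhausted_list[OF assms, of "[x, y]"] xy by auto
  have "D0 (Suc 2) (\<lambda>e :: 'a hset list. e ! 0 = e ! 1 \<or> e ! 0 \<in> elts (e ! 2))"
    by (intro D0_intros) simp_all
  from Lset_separation[OF this \<kappa>]
  obtain s where "s \<in> Lset \<rho>" "elts s = {u \<in> Lset \<kappa>. u = x \<or> u \<in> elts y}" by (auto simp: numeral_2_eq_2)
  moreover have "elts y \<subseteq> Lset \<kappa>" using \<kappa>(2) transitive_Lset unfolding transitive_def by auto
  ultimately have "s = adjoin x y" using \<kappa>(2) by (auto simp: adjoin_iff)
  then show "adjoin x y \<in> Lset \<rho>" using \<open>s \<in> Lset \<rho>\<close> by simp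
qed

text \<open>
  The existence of \<open>adjoin x y\<close> is a \<open>\<Sigma>\<^sub>1\<close> statement about \<open>x\<close> and \<open>y\<close>.
\<close>

lemma stable_closed:
  assumes st: "stable A \<rho> \<kappa>" and cl: "closed (Lset \<rho>)"
  shows "closed (Lset \<kappa>)"
  unfolding closed_def
proof (intro conjI ballI)
  have sub: "Lset \<kappa> \<subseteq> Lset \<rho>" using st unfolding stable_def elementary_wrt_def by blast
  have *: "\<exists>u\<in>Lset \<kappa>. P (u # bs)"
    if P: "D0 (Suc (length bs)) P" "\<exists>u\<in>Lset \<rho>. P (u # bs)" "bs \<in> lists (Lset \<kappa>)" for P bs
  proof -
    obtain d where d: "Delta0 d" "pure d" "arity d \<le> Suc (length bs)"
      "\<And>M A cs. transitive M \<Longrightarrow> cs \<in> lists M \<Longrightarrow> length cs = Suc (length bs) \<Longrightarrow> sat M A d cs \<longleftrightarrow> P cs"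
      using P(1) by (rule D0E) blast
    have "Sigma_fm 1 (Ex d)" unfolding One_nat_def by (intro Sigma_fm_Pi_fm.intros d)
    then have "sat (Lset \<kappa>) {} (Ex d) bs \<longleftrightarrow> sat (Lset \<rho>) {} (Ex d) bs"
      by (rule stable_Sigma1[OF st]) (use d P(3) in auto)
    moreover have "bs \<in> lists (Lset \<rho>)" using P(3) lists_mono[OF sub] by blast
    ultimately show ?thesis
      using d(4)[OF transitive_Lset, of "_ # bs"] P by auto
  qed
  show "hempty \<in> Lset \<kappa>"
    using *[of "[]" "\<lambda>e. e ! 0 = hempty"] closed_hempty[OF cl] by (simp add: D0_hempty isvar_nth)
  fix x y assume xy: "x \<in> Lset \<kappa>" "y \<in> Lset \<kappa>"
  then have "adjoin x y \<in> Lset \<rho>" using closed_adjoin[OF cl] sub by blast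
  then show "adjoin x y \<in> Lset \<kappa>"
    using *[of "[x, y]" "\<lambda>e. e ! 0 = adjoin (e ! 1) (e ! 2)"] xy by (simp add: D0_adjoin isvar_nth numeral_2_eq_2)
qed

section \<open>Recursively subtle ordinals are \<open>\<Sigma>\<^sub>2\<close>-nonprojectible\<close>

text \<open>
  What is used of recursive subtlety: the reflection property for the universal class and a valid
  formula, which yields stable levels containing any given parameters.
\<close>

definition stably_exhausted :: "'k hset \<Rightarrow> bool" where
  "stably_exhausted \<rho> \<longleftrightarrow> (\<forall>bs\<in>lists (Lset \<rho>). bs \<noteq> [] \<longrightarrow>
     (\<exists>\<kappa>\<in>elts \<rho>. stable (universal \<rho>) \<rho> \<kappa> \<and> bs \<in> lists (Lset \<kappa>)))"

lemma subtle_stably_exhausted: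
  assumes "recursively_subtle \<rho>"
  shows "stably_exhausted \<rho>"
  unfolding stably_exhausted_def
proof (intro ballI impI)
  fix bs :: "'a hset list"
  assume bs: "bs \<in> lists (Lset \<rho>)" "bs \<noteq> []"
  have "Pi_fm 2 (Eq 0 0)"
    unfolding numeral_2_eq_2 by (intro Sigma_fm_Pi_fm.intros Delta0.intros)
  moreover have "Pi2_reflecting_onto \<rho> {\<kappa> \<in> elts \<rho>. stable (universal \<rho>) \<rho> \<kappa>}"
    using assms rec_enumerable_universal[of \<rho>] universal_subset[of \<rho>]
    unfolding recursively_subtle_def by simp
  moreover have "arity (Eq 0 0) \<le> length bs" using bs(2) by (cases bs) auto
  moreover have "sat (Lset \<rho>) {} (Eq 0 0) bs" "pure (Eq 0 0)" by simp_all
  ultimately have "\<exists>\<alpha>\<in>elts \<rho>. \<alpha> \<in> {\<kappa> \<in> elts \<rho>. stable (universal \<rho>) \<rho> \<kappa>} \<and>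
      bs \<in> lists (Lset \<alpha>) \<and> sat (Lset \<alpha>) {} (Eq 0 0) bs"
    using bs unfolding Pi2_reflecting_onto_def by blast
  then show "\<exists>\<kappa>\<in>elts \<rho>. stable (universal \<rho>) \<rho> \<kappa> \<and> bs \<in> lists (Lset \<kappa>)"
    by blast
qed

lemma stably_exhausted_exhausted: "stably_exhausted \<rho> \<Longrightarrow> exhausted \<rho>"
  unfolding exhausted_def
proof
  fix b assume "stably_exhausted \<rho>" "b \<in> Lset \<rho>"
  then have "\<exists>\<kappa>\<in>elts \<rho>. stable (universal \<rho>) \<rho> \<kappa> \<and> [b] \<in> lists (Lset \<kappa>)"
    unfolding stably_exhausted_def by (elim ballE[of _ _ "[b]"]) simp_all
  then show "\<exists>\<kappa>\<in>elts \<rho>. b \<in> Lset \<kappa>" by auto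
qed

lemma union_in_Lset:
  assumes "Ord \<rho>" "exhausted \<rho>" "\<beta> \<in> elts \<rho>" "s \<in> Lset \<rho>" "t \<in> Lset \<rho>"
  shows "\<exists>u\<in>Lset \<rho>. elts u = elts s \<union> elts t"
proof -
  obtain \<kappa> where \<kappa>: "\<kappa> \<in> elts \<rho>" "[s, t] \<in> lists (Lset \<kappa>)"
    using exhausted_list[OF assms(1-3), of "[s, t]"] assms(4,5) by auto
  have "D0 (Suc 2) (\<lambda>e :: 'a hset list. e ! 0 \<in> elts (e ! 1) \<or> e ! 0 \<in> elts (e ! 2))"
    by (intro D0_intros) simp_all
  from Lset_separation[OF this \<kappa>]
  obtain u where "u \<in> Lset \<rho>" "elts u = {x \<in> Lset \<kappa>. x \<in> elts s \<or> x \<in> elts t}"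
    by (auto simp: numeral_2_eq_2)
  moreover have "elts s \<subseteq> Lset \<kappa>" "elts t \<subseteq> Lset \<kappa>"
    using \<kappa>(2) transitive_Lset unfolding transitive_def by auto
  ultimately show ?thesis by (intro bexI[of _ u]) auto
qed

lemma hintikka_hempty: "hintikka z hempty"
  unfolding hintikka_def by simp

text \<open>
  The true positions of one fixed formula over \<open>L\<^sub>\<kappa>\<close> form a \<open>\<Delta>\<^sub>0\<close> subset of any level that contains \<open>L\<^sub>\<kappa>\<close>
  and is closed under pairing. Stable levels are closed in this way.
\<close>

lemma truth_set_in_Lset:
  assumes "Ord \<rho>" "stably_exhausted \<rho>" "\<kappa> \<in> elts \<rho>" "pure p" "arity p \<le> n" "c \<in> Lset \<rho>"
  shows "\<exists>s\<in>Lset \<rho>. elts s = {pair c (env xs) | xs. xs \<in> lists (Lset \<kappa>) \<and> length xs = n \<and>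
    (sat (Lset \<kappa>) {} p xs \<longleftrightarrow> b)}"
proof -
  have cl: "closed (Lset \<rho>)"
    using exhausted_closed[OF assms(1) stably_exhausted_exhausted[OF assms(2)] assms(3)] .
  define z where "z = mk (Lset \<kappa>)"
  have z: "elts z = Lset \<kappa>" unfolding z_def by (rule elts_mk_Lset)
  have "[z, c] \<in> lists (Lset \<rho>)" using assms(6) mk_Lset_in[OF assms(3)] unfolding z_def by auto
  then obtain \<mu> where \<mu>: "\<mu> \<in> elts \<rho>" "stable (universal \<rho>) \<rho> \<mu>" "[z, c] \<in> lists (Lset \<mu>)"
    using assms(2) unfolding stably_exhausted_def by blast
  have cl\<mu>: "closed (Lset \<mu>)" using stable_closed[OF \<mu>(2) cl] .
  have sub: "Lset \<kappa> \<subseteq> Lset \<mu>"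
    using \<mu>(3) transitive_Lset[of \<mu>] z unfolding transitive_def by auto
  have seg: "isvars (n + Suc 2) n (take n)" using isvars_segment[of 0 n "n + Suc 2"] by simp
  have v: "isvar (n + Suc 2) (\<lambda>e. drop n e ! i)" if "i < 3" for i
    by (rule isvar_cong[OF isvar_nth[of "n + i" "n + Suc 2"]]) (use that in simp_all)
  have r: "D0 (n + Suc 2) (\<lambda>e. sat (elts (drop n e ! 1)) {} p (take n e) \<longleftrightarrow> b)"
    using D0_relativised_pure[OF assms(4) v[of 1] seg assms(5)]
      D0_Not[OF D0_relativised_pure[OF assms(4) v[of 1] seg assms(5)]]
    by (cases b) simp_all
  have "D0 (Suc 2) (\<lambda>e. \<exists>xs\<in>lists (elts (e ! 1)). length xs = n \<and>
      (e ! 0 = pair (e ! 2) (env xs) \<and> (sat (elts (e ! 1)) {} p xs \<longleftrightarrow> b)))"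
    by (intro D0_BEx_list D0_And r D0_pair_env[OF seg] v isvar_nth) simp_all
  from Lset_separation[OF this \<mu>(1) \<mu>(3)]
  obtain s where s: "s \<in> Lset \<rho>" "elts s = {u \<in> Lset \<mu>. \<exists>xs\<in>lists (elts z). length xs = n \<and>
      (u = pair c (env xs) \<and> (sat (elts z) {} p xs \<longleftrightarrow> b))}"
    by (auto simp: numeral_2_eq_2)
  have "pair c (env xs) \<in> Lset \<mu>" if "xs \<in> lists (Lset \<kappa>)" for xs
    using that lists_mono[OF sub] \<mu>(3) by (intro closed_pair[OF cl\<mu>] closed_env[OF cl\<mu>]) auto
  then show ?thesis using s unfolding z by (intro bexI[of _ s]) auto
qed

text \<open>
  Adding positions justified by what is already present keeps a Hintikka set a Hintikka set, since
  justification is monotone.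
\<close>

lemma hintikka_extend:
  assumes "Ord \<rho>" "stably_exhausted \<rho>" "\<kappa> \<in> elts \<rho>" "pure p" "arity p \<le> n" "c \<in> Lset \<rho>"
    and s: "s \<in> Lset \<rho>" "hintikka z s"
    and move_justified: "\<And>xs. xs \<in> lists (Lset \<kappa>) \<Longrightarrow> length xs = n \<Longrightarrow> (sat (Lset \<kappa>) {} p xs \<longleftrightarrow> b) \<Longrightarrow>
        justified z s (pair c (env xs))"
  shows "\<exists>t\<in>Lset \<rho>. hintikka z t \<and> elts s \<subseteq> elts t \<and>
    (\<forall>xs\<in>lists (Lset \<kappa>). length xs = n \<longrightarrow> (sat (Lset \<kappa>) {} p xs \<longleftrightarrow> b) \<longrightarrow> pair c (env xs) \<in> elts t)"
proof -
  obtain r where r: "r \<in> Lset \<rho>" "elts r = {pair c (env xs) | xs. xs \<in> lists (Lset \<kappa>) \<and> length xs = n \<and>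
      (sat (Lset \<kappa>) {} p xs \<longleftrightarrow> b)}"
    using truth_set_in_Lset[OF assms(1-6)] by blast
  obtain t where t: "t \<in> Lset \<rho>" "elts t = elts s \<union> elts r"
    using union_in_Lset[OF assms(1) stably_exhausted_exhausted[OF assms(2)] assms(3) s(1) r(1)] by blast
  have "justified z t w" if "w \<in> elts t" for w
    using that s(2) move_justified t(2) r(2) justified_mono[of s t z w] unfolding hintikka_def by auto
  then show ?thesis using t r(2) unfolding hintikka_def by (intro bexI[of _ t]) auto
qed

text \<open>
  By induction on \<open>p\<close>: Hintikka sets covering the immediate subformulas justify all true positions of
  \<open>p\<close>. As \<open>p\<close> is a fixed formula, finitely many separations inside \<open>L\<^sub>\<rho>\<close> suffice.
\<close>

lemma hintikka_complete:
  assumes "Ord \<rho>" "stably_exhausted \<rho>" "\<kappa> \<in> elts \<rho>" and z: "elts z = Lset \<kappa>"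
  shows "pure p \<Longrightarrow> arity p \<le> n \<Longrightarrow> \<exists>s\<in>Lset \<rho>. hintikka z s \<and>
    (\<forall>xs\<in>lists (Lset \<kappa>). length xs = n \<longrightarrow> (sat (Lset \<kappa>) {} p xs \<longleftrightarrow> b) \<longrightarrow>
       pair (code p b n) (env xs) \<in> elts s)"
proof (induction p arbitrary: b n)
  case (Mem i j)
  have cl: "closed (Lset \<rho>)"
    using exhausted_closed[OF assms(1) stably_exhausted_exhausted[OF assms(2)] assms(3)] .
  have "\<exists>t\<in>Lset \<rho>. hintikka z t \<and> elts hempty \<subseteq> elts t \<and> (\<forall>xs\<in>lists (Lset \<kappa>). length xs = n \<longrightarrow>
      (sat (Lset \<kappa>) {} (Mem i j) xs \<longleftrightarrow> b) \<longrightarrow> pair (code (Mem i j) b n) (env xs) \<in> elts t)"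
    by (rule hintikka_extend[OF assms(1-3) Mem closed_code[OF cl] closed_hempty[OF cl] hintikka_hempty])
       (use Mem in \<open>auto simp: move_justified_def lookup_env z\<close>)
  then show ?case by blast
next
  case (Eq i j)
  have cl: "closed (Lset \<rho>)"
    using exhausted_closed[OF assms(1) stably_exhausted_exhausted[OF assms(2)] assms(3)] .
  have "\<exists>t\<in>Lset \<rho>. hintikka z t \<and> elts hempty \<subseteq> elts t \<and> (\<forall>xs\<in>lists (Lset \<kappa>). length xs = n \<longrightarrow>
      (sat (Lset \<kappa>) {} (Eq i j) xs \<longleftrightarrow> b) \<longrightarrow> pair (code (Eq i j) b n) (env xs) \<in> elts t)"
    by (rule hintikka_extend[OF assms(1-3) Eq closed_code[OF cl] closed_hempty[OF cl] hintikka_hempty])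
       (use Eq in \<open>auto simp: move_justified_def lookup_env z\<close>)
  then show ?case by blast
next
  case (Neg p)
  then show ?case using Neg.IH[of n "\<not> b"] by (cases b) simp_all
next
  case (Conj p q)
  have "closed (Lset \<rho>)"
    using exhausted_closed[OF assms(1) stably_exhausted_exhausted[OF assms(2)] assms(3)] .
  note code_in = closed_code[OF this]
  have ar: "pure p" "pure q" "arity p \<le> n" "arity q \<le> n" using Conj.prems by simp_all
  obtain s where s: "s \<in> Lset \<rho>" "hintikka z s"
    "\<And>xs. xs \<in> lists (Lset \<kappa>) \<Longrightarrow> length xs = n \<Longrightarrow> (sat (Lset \<kappa>) {} p xs \<longleftrightarrow> b) \<Longrightarrow> pair (code p b n) (env xs) \<in> elts s"
    using Conj.IH(1)[OF ar(1,3), of b]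
    by (elim bexE conjE) (rule that, assumption, assumption, drule (1) bspec, simp)
  obtain t where t: "t \<in> Lset \<rho>" "hintikka z t"
    "\<And>xs. xs \<in> lists (Lset \<kappa>) \<Longrightarrow> length xs = n \<Longrightarrow> (sat (Lset \<kappa>) {} q xs \<longleftrightarrow> b) \<Longrightarrow> pair (code q b n) (env xs) \<in> elts t"
    using Conj.IH(2)[OF ar(2,4), of b]
    by (elim bexE conjE) (rule that, assumption, assumption, drule (1) bspec, simp)
  obtain u where u: "u \<in> Lset \<rho>" "elts u = elts s \<union> elts t"
    using union_in_Lset[OF assms(1) stably_exhausted_exhausted[OF assms(2)] assms(3) s(1) t(1)] by blast
  have "hintikka z u"
    using s(2) t(2) justified_mono[of s u z] justified_mono[of t u z] u(2) unfolding hintikka_def by blast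
  have "\<exists>v\<in>Lset \<rho>. hintikka z v \<and> elts u \<subseteq> elts v \<and> (\<forall>xs\<in>lists (Lset \<kappa>). length xs = n \<longrightarrow>
      (sat (Lset \<kappa>) {} (Conj p q) xs \<longleftrightarrow> b) \<longrightarrow> pair (code (Conj p q) b n) (env xs) \<in> elts v)"
  proof (rule hintikka_extend[OF assms(1-3) Conj.prems code_in u(1) \<open>hintikka z u\<close>])
    fix xs assume "xs \<in> lists (Lset \<kappa>)" "length xs = n" "sat (Lset \<kappa>) {} (Conj p q) xs \<longleftrightarrow> b"
    then show "justified z u (pair (code (Conj p q) b n) (env xs))"
      using s(3)[of xs] t(3)[of xs] u(2) by (auto simp: move_justified_def)
  qed
  then show ?case by blast
next
  case (Ex p)
  have "closed (Lset \<rho>)"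
    using exhausted_closed[OF assms(1) stably_exhausted_exhausted[OF assms(2)] assms(3)] .
  note code_in = closed_code[OF this]
  have ar: "pure p" "arity p \<le> Suc n" using Ex.prems by simp_all
  obtain s where s: "s \<in> Lset \<rho>" "hintikka z s"
    "\<And>xs. xs \<in> lists (Lset \<kappa>) \<Longrightarrow> length xs = Suc n \<Longrightarrow> (sat (Lset \<kappa>) {} p xs \<longleftrightarrow> b) \<Longrightarrow>
      pair (code p b (Suc n)) (env xs) \<in> elts s"
    using Ex.IH[OF ar, of b] by (elim bexE conjE) (rule that, assumption, assumption, drule (1) bspec, simp)
  have "\<exists>v\<in>Lset \<rho>. hintikka z v \<and> elts s \<subseteq> elts v \<and> (\<forall>xs\<in>lists (Lset \<kappa>). length xs = n \<longrightarrow>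
      (sat (Lset \<kappa>) {} (Ex p) xs \<longleftrightarrow> b) \<longrightarrow> pair (code (Ex p) b n) (env xs) \<in> elts v)"
  proof (rule hintikka_extend[OF assms(1-3) Ex.prems code_in s(1,2)])
    fix xs assume xs: "xs \<in> lists (Lset \<kappa>)" "length xs = n" "sat (Lset \<kappa>) {} (Ex p) xs \<longleftrightarrow> b"
    have "pair (code p b (Suc n)) (adjoin (pair (hnum n) x) (env xs)) \<in> elts s"
      if "x \<in> Lset \<kappa>" "sat (Lset \<kappa>) {} p (x # xs) \<longleftrightarrow> b" for x
      using s(3)[of "x # xs"] xs that by simp
    then show "justified z s (pair (code (Ex p) b n) (env xs))"
      using xs(3) by (cases b) (auto simp: move_justified_def z)
  qed
  then show ?case by blast
qed simp

text \<open>
  If \<open>p\<close> holds in \<open>L\<^sub>\<rho>\<close>, it holds in some stable level that contains the position itself, and this level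
  serves as \<open>z\<close>. Conversely truth in \<open>z\<close> persists to \<open>L\<^sub>\<rho>\<close>.
\<close>

lemma universal_iff:
  assumes "Ord \<rho>" "stably_exhausted \<rho>" "Sigma_fm 1 p" "pure p" "arity p \<le> length xs"
    "xs \<in> lists (Lset \<rho>)" "\<beta> \<in> elts \<rho>"
  shows "pair (code p True (length xs)) (env xs) \<in> universal \<rho> \<longleftrightarrow> sat (Lset \<rho>) {} p xs"
proof -
  define w where "w = pair (code p True (length xs)) (env xs)"
  have cl: "closed (Lset \<rho>)"
    using exhausted_closed[OF assms(1) stably_exhausted_exhausted[OF assms(2)] assms(7)] .
  have w: "w \<in> Lset \<rho>"
    unfolding w_def using assms(6) by (intro closed_pair[OF cl] closed_code[OF cl] closed_env[OF cl])
  \<comment> \<open>The values of the assignment lie in the transitive closure of the position.\<close>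
  have xs_in: "xs \<in> lists M" if "transitive M" "w \<in> M" for M
  proof -
    have "upair (code p True (length xs)) (env xs) \<in> M"
      using transitiveD[OF that] unfolding w_def pair_def by simp
    then have "env xs \<in> M" using transitiveD[OF that(1)] by simp
    then have "ys \<in> lists M" if "elts (env ys) \<subseteq> elts (env xs)" for ys
      using that
    proof (induction ys)
      case (Cons y ys)
      then have "pair (hnum (length ys)) y \<in> M"
        using transitiveD[OF \<open>transitive M\<close> \<open>env xs \<in> M\<close>] by simp
      then have "upair (hnum (length ys)) y \<in> M"
        using transitiveD[OF \<open>transitive M\<close>] unfolding pair_def by simp
      then have "y \<in> M" using transitiveD[OF \<open>transitive M\<close>] by simp
      then show ?case using Cons by simp
    qed simp
    then show ?thesis by blast
  qed
  show ?thesis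
    unfolding w_def[symmetric]
  proof
    assume "w \<in> universal \<rho>"
    then obtain z s where z: "z \<in> Lset \<rho>" "transitive (elts z)" "w \<in> elts z" "w \<in> elts s" "hintikka z s"
      unfolding universal_def by blast
    have xs: "xs \<in> lists (elts z)" using xs_in z by blast
    have "sat (elts z) {} p xs"
      using hintikka_sound[OF z(5) assms(4,5) xs, of True] z(4) unfolding w_def by simp
    moreover have "elts z \<subseteq> Lset \<rho>" using z(1) transitive_Lset unfolding transitive_def by blast
    ultimately show "sat (Lset \<rho>) {} p xs"
      using sat_empty_persistent[OF _ z(2) transitive_Lset _ xs assms(5)] assms(3) by simp
  next
    assume *: "sat (Lset \<rho>) {} p xs"
    have "[w] \<in> lists (Lset \<rho>)" using w by simp
    then obtain \<kappa> where \<kappa>: "\<kappa> \<in> elts \<rho>" "stable (universal \<rho>) \<rho> \<kappa>" "[w] \<in> lists (Lset \<kappa>)"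
      using assms(2) unfolding stably_exhausted_def by blast
    then have xs: "xs \<in> lists (Lset \<kappa>)" using xs_in transitive_Lset by auto
    have sat: "sat (Lset \<kappa>) {} p xs"
      using stable_Sigma1[OF \<kappa>(2) assms(3,4) xs assms(5)] * by blast
    obtain s where s: "s \<in> Lset \<rho>" "hintikka (mk (Lset \<kappa>)) s" "w \<in> elts s"
      using hintikka_complete[OF assms(1,2) \<kappa>(1) elts_mk_Lset assms(4,5), of True] xs sat
      unfolding w_def by blast
    then show "w \<in> universal \<rho>"
      unfolding universal_def using w \<kappa>(3) mk_Lset_in[OF \<kappa>(1)] transitive_Lset[of \<kappa>]
      by (intro CollectI conjI bexI[of _ "mk (Lset \<kappa>)"] bexI[of _ s]) (simp_all add: elts_mk_Lset)
  qed
qed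

text \<open>
  A \<open>\<Pi>\<^sub>1\<close> formula \<open>q\<close> is replaced by the statement that the position of its negation, with the given
  assignment, exists and lies outside \<open>universal \<rho>\<close>; unbounded existential quantifiers are copied. The
  second half of the conclusion concerns \<open>L\<^sub>\<kappa>\<close> but still refers to \<open>universal \<rho>\<close>, that is, to truth in
  \<open>L\<^sub>\<rho>\<close>; stability then transfers the \<open>\<Pi>\<^sub>1\<close> kernel down to \<open>L\<^sub>\<kappa>\<close>.
\<close>

lemma Sigma2_translation:
  assumes "Ord \<rho>" "stably_exhausted \<rho>" "\<kappa> \<in> elts \<rho>" and st: "stable (universal \<rho>) \<rho> \<kappa>"
  shows "Sigma_fm 2 q \<Longrightarrow> pure q \<Longrightarrow> arity q \<le> m \<Longrightarrow>
    \<exists>p cs. Sigma_fm 1 p \<and> arity p \<le> m + length cs \<and> cs \<in> lists (Lset \<kappa>) \<and>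
      (\<forall>bs\<in>lists (Lset \<rho>). length bs = m \<longrightarrow> sat (Lset \<rho>) {} q bs \<longrightarrow>
        sat (Lset \<rho>) (universal \<rho> \<inter> Lset \<rho>) p (bs @ cs)) \<and>
      (\<forall>bs\<in>lists (Lset \<kappa>). length bs = m \<longrightarrow> sat (Lset \<kappa>) (universal \<rho> \<inter> Lset \<kappa>) p (bs @ cs) \<longrightarrow>
        sat (Lset \<kappa>) {} q bs)"
proof (induction q arbitrary: m rule: Sigma_fm_2_induct)
  case (Pi1 q)
  obtain r where r: "Sigma_fm 1 r" "arity r = arity q" "pure r = pure q"
      "\<And>M A bs. sat (M :: 'a hset set) A r bs \<longleftrightarrow> \<not> sat M A q bs"
    using dual_formula(2)[OF Pi1(1)] by blast
  define c :: "'a hset" where "c = code r True m"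
  have cl: "closed (Lset \<rho>)"
    using exhausted_closed[OF assms(1) stably_exhausted_exhausted[OF assms(2)] assms(3)] .
  have cl\<kappa>: "closed (Lset \<kappa>)" using stable_closed[OF st cl] .
  have c: "c \<in> Lset \<rho>" "c \<in> Lset \<kappa>"
    unfolding c_def using closed_code cl cl\<kappa> by blast+
  have sub: "Lset \<kappa> \<subseteq> Lset \<rho>" using assms(3) by (rule Lset_elt_subset)
  have U: "pair c (env bs) \<in> universal \<rho> \<longleftrightarrow> \<not> sat (Lset \<rho>) {} q bs"
    if "bs \<in> lists (Lset \<rho>)" "length bs = m" for bs
    using universal_iff[OF assms(1,2) r(1) _ _ that(1) assms(3)] Pi1 r that(2) unfolding c_def by simp
  have "D0 (Suc (Suc m)) (\<lambda>e. e ! 0 = pair (e ! Suc m) (env (take m (drop 1 e))))"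
    by (intro D0_pair_env[where n = m] isvars_segment isvar_nth) simp_all
  then obtain d where d: "Delta0 d" "pure d" "arity d \<le> Suc (Suc m)"
    "\<And>M A bs. transitive M \<Longrightarrow> bs \<in> lists M \<Longrightarrow> length bs = Suc (Suc m) \<Longrightarrow>
       sat M A d bs \<longleftrightarrow> bs ! 0 = pair (bs ! Suc m) (env (take m (drop 1 bs)) :: 'a hset)"
    by (rule D0E) blast
  define p where "p = Ex (Conj d (Neg (Pr 0)))"
  have p: "Sigma_fm 1 p"
    unfolding p_def One_nat_def by (intro Sigma_fm_Pi_fm.intros Delta0.intros d)
  have sat_p: "sat M A p (bs @ [c]) \<longleftrightarrow> (\<exists>w\<in>M. w = pair c (env bs) \<and> w \<notin> A)"
    if "transitive M" "c \<in> M" "bs \<in> lists M" "length bs = m" for M A bs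
    unfolding p_def using d(4)[OF that(1), of "_ # bs @ [c]" A] that by (auto simp: nth_append)
  show ?case
  proof (intro exI[of _ p] exI[of _ "[c]"] conjI ballI impI)
    fix bs assume bs: "bs \<in> lists (Lset \<rho>)" "length bs = m" "sat (Lset \<rho>) {} q bs"
    have "pair c (env bs) \<in> Lset \<rho>"
      by (intro closed_pair[OF cl] closed_env[OF cl] c bs)
    then show "sat (Lset \<rho>) (universal \<rho> \<inter> Lset \<rho>) p (bs @ [c])"
      using sat_p[OF transitive_Lset c(1) bs(1,2)] U[OF bs(1,2)] bs(3) by auto
  next
    fix bs assume bs: "bs \<in> lists (Lset \<kappa>)" "length bs = m"
      "sat (Lset \<kappa>) (universal \<rho> \<inter> Lset \<kappa>) p (bs @ [c])"
    have "bs \<in> lists (Lset \<rho>)" using bs(1) lists_mono[OF sub] by blast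
    moreover have "pair c (env bs) \<notin> universal \<rho>"
      using bs(3) sat_p[OF transitive_Lset c(2) bs(1,2)] by auto
    ultimately have "sat (Lset \<rho>) {} q bs" using U bs(2) by blast
    then show "sat (Lset \<kappa>) {} q bs"
      using stable_Pi1[OF st Pi1(1,2) bs(1)] Pi1(3) bs(2) by simp
  qed (use p c d in \<open>auto simp: p_def\<close>)
next
  case (Ex q)
  have ar: "pure q" "arity q \<le> Suc m" using Ex.prems by simp_all
  obtain p cs where p: "Sigma_fm 1 p" "arity p \<le> Suc m + length cs" "cs \<in> lists (Lset \<kappa>)"
    "\<And>bs. bs \<in> lists (Lset \<rho>) \<Longrightarrow> length bs = Suc m \<Longrightarrow> sat (Lset \<rho>) {} q bs \<Longrightarrow>
        sat (Lset \<rho>) (universal \<rho> \<inter> Lset \<rho>) p (bs @ cs)"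
    "\<And>bs. bs \<in> lists (Lset \<kappa>) \<Longrightarrow> length bs = Suc m \<Longrightarrow>
        sat (Lset \<kappa>) (universal \<rho> \<inter> Lset \<kappa>) p (bs @ cs) \<Longrightarrow> sat (Lset \<kappa>) {} q bs"
    using Ex.IH[OF ar] by (elim exE conjE) (rule that, auto)
  have "Sigma_fm 1 (Ex p)" using p(1) by (simp add: Sigma_fm_Pi_fm.intros)
  moreover have "sat (Lset \<rho>) (universal \<rho> \<inter> Lset \<rho>) (Ex p) (bs @ cs)"
    if bs: "bs \<in> lists (Lset \<rho>)" "length bs = m" and q: "sat (Lset \<rho>) {} (Ex q) bs" for bs
  proof -
    obtain x where "x \<in> Lset \<rho>" "sat (Lset \<rho>) {} q (x # bs)" using q by auto
    then show ?thesis using p(4)[of "x # bs"] bs by auto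
  qed
  moreover have "sat (Lset \<kappa>) {} (Ex q) bs"
    if bs: "bs \<in> lists (Lset \<kappa>)" "length bs = m"
      and q: "sat (Lset \<kappa>) (universal \<rho> \<inter> Lset \<kappa>) (Ex p) (bs @ cs)" for bs
  proof -
    obtain x where "x \<in> Lset \<kappa>" "sat (Lset \<kappa>) (universal \<rho> \<inter> Lset \<kappa>) p ((x # bs) @ cs)"
      using q by auto
    then show ?thesis using p(5)[of "x # bs"] bs by auto
  qed
  ultimately show ?case
    using p(2,3) by (intro exI[of _ "Ex p"] exI[of _ cs]) auto
qed

lemma Sigma2_persistent:
  assumes "stable A \<rho> \<kappa>"
  shows "Sigma_fm 2 q \<Longrightarrow> pure q \<Longrightarrow> bs \<in> lists (Lset \<kappa>) \<Longrightarrow> arity q \<le> length bs \<Longrightarrow>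
    sat (Lset \<kappa>) {} q bs \<Longrightarrow> sat (Lset \<rho>) {} q bs"
proof (induction q arbitrary: bs rule: Sigma_fm_2_induct)
  case (Pi1 q)
  then show ?case using stable_Pi1[OF assms] by blast
next
  case (Ex q)
  then obtain x where x: "x \<in> Lset \<kappa>" "sat (Lset \<kappa>) {} q (x # bs)" by auto
  then have "sat (Lset \<rho>) {} q (x # bs)" using Ex.prems by (intro Ex.IH) auto
  then show ?case using x assms unfolding stable_def elementary_wrt_def by auto
qed

lemma stable_universal_Sigma2_elementary:
  assumes "Ord \<rho>" "stably_exhausted \<rho>" "\<kappa> \<in> elts \<rho>" "stable (universal \<rho>) \<rho> \<kappa>"
  shows "Sigma_elementary 2 (Lset \<kappa>) (Lset \<rho>)"
proof -
  have sub: "Lset \<kappa> \<subseteq> Lset \<rho>" using assms(3) by (rule Lset_elt_subset)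
  have "sat (Lset \<kappa>) {} q bs"
    if q: "Sigma_fm 2 q" "pure q" "arity q \<le> length bs" and bs: "bs \<in> lists (Lset \<kappa>)"
      and sat: "sat (Lset \<rho>) {} q bs" for q bs
  proof -
    obtain p cs where p: "Sigma_fm 1 p" "arity p \<le> length bs + length cs" "cs \<in> lists (Lset \<kappa>)"
      "sat (Lset \<rho>) {} q bs \<Longrightarrow> sat (Lset \<rho>) (universal \<rho> \<inter> Lset \<rho>) p (bs @ cs)"
      "sat (Lset \<kappa>) (universal \<rho> \<inter> Lset \<kappa>) p (bs @ cs) \<Longrightarrow> sat (Lset \<kappa>) {} q bs"
      using Sigma2_translation[OF assms q] bs lists_mono[OF sub] by blast
    have "sat (Lset \<kappa>) (universal \<rho> \<inter> Lset \<kappa>) p (bs @ cs) \<longleftrightarrow>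
        sat (Lset \<rho>) (universal \<rho> \<inter> Lset \<rho>) p (bs @ cs)"
      using assms(4) p(1-3) bs unfolding stable_def elementary_wrt_def by simp
    then show ?thesis using p(4,5) sat by blast
  qed
  then have "sat (Lset \<kappa>) {} q bs \<longleftrightarrow> sat (Lset \<rho>) {} q bs"
    if "Sigma_fm 2 q" "pure q" "arity q \<le> length bs" "bs \<in> lists (Lset \<kappa>)" for q bs
    using Sigma2_persistent[OF assms(4)] that by blast
  then show ?thesis
    unfolding Sigma_elementary_def elementary_wrt_def using sub by simp
qed

lemma subtle_nonprojectible:
  assumes "Ord \<rho>" "recursively_subtle \<rho>"
  shows "Sigma2_nonprojectible \<rho>"
  unfolding Sigma2_nonprojectible_def
proof
  fix \<beta> assume \<beta>: "\<beta> \<in> elts \<rho>"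
  note st = subtle_stably_exhausted[OF assms(2)]
  have "[mk (Lset \<beta>)] \<in> lists (Lset \<rho>)" using mk_Lset_in[OF \<beta>] by simp
  then obtain \<kappa> where \<kappa>: "\<kappa> \<in> elts \<rho>" "stable (universal \<rho>) \<rho> \<kappa>" "mk (Lset \<beta>) \<in> Lset \<kappa>"
    using st unfolding stably_exhausted_def by (elim ballE[of _ _ "[mk (Lset \<beta>)]"]) auto
  have "Ord \<kappa>" "Ord \<beta>" using Ord_elt[OF assms(1)] \<kappa>(1) \<beta> by blast+
  then have "elts \<beta> \<subseteq> elts \<kappa>" using mk_Lset_inD[OF _ _ subset_refl \<kappa>(3)] Ord_trans by blast
  then show "\<exists>\<eta>\<in>elts \<rho>. elts \<beta> \<subseteq> elts \<eta> \<and> Sigma_elementary 2 (Lset \<eta>) (Lset \<rho>)"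
    using \<kappa>(1) stable_universal_Sigma2_elementary[OF assms(1) st \<kappa>(1,2)] by blast
qed

theorem corollary2p14:
  fixes \<rho> :: "'k hset"
  assumes "Ord \<rho>"
  shows "Sigma2_nonprojectible \<rho> \<longleftrightarrow> recursively_subtle \<rho>"
  using nonprojectible_subtle[OF assms] subtle_nonprojectible[OF assms] by blast

end
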